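(* If $A$ is a general point of $\{A\in M_{n+1}(k)\mid \operatorname{rank}(A)=n\}$, then $A\sim W_{n-1}$. That is, there is a dense Zariski-open subset $U$ of $\{A\in M_{n+1}(k)\mid \operatorname{rank}(A)=n\}$ such that for every $A\in U$ there exists $T\in GL_{n+1}(k)$ with ${}^tTAT^{(q)}=W_{n-1}$.
   Context: $k$ is an algebraically closed field of characteristic $p>0$, $q$ is a power of $p$ (so $q=p^e$ with $e\ge 1$), and $n$ is a positive integer. $M_{n+1}(k)$ is the set of $(n+1)\times(n+1)$ matrices over $k$. For a matrix $T$, ${}^tT$ is its transpose and $T^{(q)}$ is the matrix obtained by raising each entry to the $q$-th power. For $A,A'\in M_{n+1}(k)$, $A\sim A'$ means that there exists $T\in GL_{n+1}(k)$ with $A'={}^tTAT^{(q)}$. $I_s$ is the $s\times s$ identity matrix, $E_r$ is the $r\times r$ matrix with entries $1$ on the subdiagonal (positions $(i+1,i)$) and $0$ elsewhere, and $W_s=\left(\begin{array}{c|c} I_s & 0\\ \hline 0 & E_{n-s+1}\end{array}\right)\in M_{n+1}(k)$ for $0\le s\le n$; thus $W_{n-1}$ is block diagonal with blocks $I_{n-1}$ and $E_2=\begin{pmatrix}0&0\\1&0\end{pmatrix}$. *)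

theory Defs
  imports
    "HOL-Computational_Algebra.Computational_Algebra"
    "HOL-Analysis.Abstract_Topology"
    "Jordan_Normal_Form.DL_Rank"
begin

text \<open>Square matrices of size \<open>N\<close> are the elements of \<^term>\<open>carrier_mat N N\<close>; the first matrix index
  is \<open>0\<close>.\<close>

definition frob_twist :: "nat \<Rightarrow> 'a::field mat \<Rightarrow> 'a mat" where
  "frob_twist q T = map_mat (\<lambda>x. x ^ q) T"

definition frob_equiv :: "nat \<Rightarrow> nat \<Rightarrow> 'a::field mat \<Rightarrow> 'a mat \<Rightarrow> bool" where
  "frob_equiv N q A A' \<longleftrightarrow>
     (\<exists>T \<in> carrier_mat N N. invertible_mat T \<and> A' = transpose_mat T * A * frob_twist q T)"

definition subdiag_mat :: "nat \<Rightarrow> 'a::field mat" where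
  "subdiag_mat r = mat r r (\<lambda>(i, j). if i = j + 1 then 1 else 0)"

text \<open>Only meaningful for \<open>s \<le> n\<close>, where the result has size \<open>n + 1\<close>; otherwise the subtraction
  truncates.\<close>

definition W_mat :: "nat \<Rightarrow> nat \<Rightarrow> 'a::field mat" where
  "W_mat n s = four_block_mat (1\<^sub>m s) (0\<^sub>m s (n - s + 1))
                              (0\<^sub>m (n - s + 1) s) (subdiag_mat (n - s + 1))"

text \<open>The ring of polynomial functions in the \<open>N\<^sup>2\<close> matrix entries, i.e. the coordinate ring of the
  affine space of square matrices.\<close>

inductive_set poly_funs :: "nat \<Rightarrow> ('a::field mat \<Rightarrow> 'a) set" for N :: nat where
  const: "(\<lambda>_. c) \<in> poly_funs N"
| entry: "i < N \<Longrightarrow> j < N \<Longrightarrow> (\<lambda>A. A $$ (i, j)) \<in> poly_funs N"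
| add: "f \<in> poly_funs N \<Longrightarrow> g \<in> poly_funs N \<Longrightarrow> (\<lambda>A. f A + g A) \<in> poly_funs N"
| mult: "f \<in> poly_funs N \<Longrightarrow> g \<in> poly_funs N \<Longrightarrow> (\<lambda>A. f A * g A) \<in> poly_funs N"

definition zero_locus :: "nat \<Rightarrow> ('a::field mat \<Rightarrow> 'a) set \<Rightarrow> 'a mat set" where
  "zero_locus N S = {A \<in> carrier_mat N N. \<forall>f \<in> S. f A = 0}"

definition zariski_open :: "nat \<Rightarrow> 'a::field mat set \<Rightarrow> bool" where
  "zariski_open N U \<longleftrightarrow> (\<exists>S \<subseteq> poly_funs N. U = carrier_mat N N - zero_locus N S)"

definition zariski_topology :: "nat \<Rightarrow> 'a::field mat topology" where
  "zariski_topology N = topology (zariski_open N)"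

lemma istopology_zariski_open: "istopology (zariski_open N :: 'a::field mat set \<Rightarrow> bool)"
  unfolding istopology_def
proof (intro conjI allI impI)
  fix U V :: "'a mat set"
  assume "zariski_open N U" "zariski_open N V"
  then obtain S S' where S: "S \<subseteq> poly_funs N" "U = carrier_mat N N - zero_locus N S"
    and S': "S' \<subseteq> poly_funs N" "V = carrier_mat N N - zero_locus N S'"
    unfolding zariski_open_def by blast
  let ?P = "{(\<lambda>A. f A * g A) | f g. f \<in> S \<and> g \<in> S'}"
  have "?P \<subseteq> poly_funs N"
    using S(1) S'(1) by (auto intro!: poly_funs.mult)
  moreover have "U \<inter> V = carrier_mat N N - zero_locus N ?P"
    unfolding S(2) S'(2) zero_locus_def by fastforce
  ultimately show "zariski_open N (U \<inter> V)"
    unfolding zariski_open_def by blast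
next
  fix \<K> :: "'a mat set set"
  assume "\<forall>K\<in>\<K>. zariski_open N K"
  then obtain S where S: "\<And>K. K \<in> \<K> \<Longrightarrow> S K \<subseteq> poly_funs N"
      "\<And>K. K \<in> \<K> \<Longrightarrow> K = carrier_mat N N - zero_locus N (S K)"
    unfolding zariski_open_def by metis
  have "(\<Union>K\<in>\<K>. S K) \<subseteq> poly_funs N"
    using S(1) by blast
  moreover have "\<Union>\<K> = (\<Union>K\<in>\<K>. carrier_mat N N - zero_locus N (S K))"
    using S(2) by auto
  then have "\<Union>\<K> = carrier_mat N N - zero_locus N (\<Union>K\<in>\<K>. S K)"
    by (auto simp: zero_locus_def)
  ultimately show "zariski_open N (\<Union>\<K>)"
    unfolding zariski_open_def by blast
qed

lemma openin_zariski_topology: "openin (zariski_topology N) = zariski_open N"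
  by (simp add: zariski_topology_def istopology_zariski_open topology_inverse')

lemma zariski_open_imp_subset: "zariski_open N U \<Longrightarrow> U \<subseteq> carrier_mat N N"
  by (auto simp: zariski_open_def)

lemma topspace_zariski_topology:
  "topspace (zariski_topology N) = (carrier_mat N N :: 'a::field mat set)"
proof -
  have "zariski_open N (carrier_mat N N :: 'a mat set)"
    unfolding zariski_open_def zero_locus_def
    by (rule exI[of _ "{\<lambda>_. 1}"]) (auto intro: poly_funs.const)
  then show ?thesis
    unfolding topspace_def openin_zariski_topology by (blast dest: zariski_open_imp_subset)
qed

definition rank_locus :: "nat \<Rightarrow> nat \<Rightarrow> 'a::field mat set" where
  "rank_locus N r = {A \<in> carrier_mat N N. vec_space.rank N A = r}"

end

theory Submission
  imports Defs "Jordan_Normal_Form.Matrix_Kernel"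
begin

text \<open>A square matrix \<open>A\<close> is the Gram matrix of the form \<open>\<beta>(v, w) = v\<^sup>T A w\<^sup>(\<^sup>q\<^sup>)\<close>, which is
linear in \<open>v\<close> and Frobenius-semilinear in \<open>w\<close>, and \<open>frob_equiv\<close> is change of basis. If \<open>A\<close> has
corank one, there is one line of vectors \<open>x\<close> with \<open>\<beta>(x, -) = 0\<close>, the left radical, and one
line of vectors \<open>y\<close> with \<open>\<beta>(-, y) = 0\<close>, the right radical. For \<open>W\<^sub>n\<^sub>-\<^sub>1\<close> these are spanned by
the last but one and the last basis vector, and \<open>\<beta>(y, x) = 1\<close>. The claim comes down to three
facts about the condition \<open>\<beta>(y, x) \<noteq> 0\<close>.

It forces the normal form (\<open>corank_one_frob_equiv\<close>). Take \<open>x\<close> and \<open>y\<close> as the last two vectors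
of a basis. As they pair nontrivially, multiples of them can be added to the other basis vectors
to make those orthogonal to \<open>x\<close> and \<open>y\<close> on both sides. What remains is a form on a complement,
which is nondegenerate since the kernel of \<open>A\<close> is only a line, and over an algebraically closed
field every nondegenerate form of this kind has an orthonormal basis
(\<open>nondegenerate_frob_equiv_one\<close>). For the last point let \<open>B\<close> be the Gram matrix. Lang's theorem
for the \<open>q\<^sup>2\<close>-power map (\<open>lang_general_linear\<close>), applied to \<open>B\<^sup>-\<^sup>T B\<^sup>(\<^sup>q\<^sup>)\<close>, gives a basis in
which \<open>B\<^sup>T = B\<^sup>(\<^sup>q\<^sup>)\<close>, so that \<open>B\<close> is a Hermitian form over the field with \<open>q\<^sup>2\<close> elements. Such
a form has a rational anisotropic vector; its left and right orthogonal complements agree, and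
one splits it off and inducts.

It is open (\<open>radical_pairing\<close>). The columns of the adjugate of \<open>A\<close> lie in the kernel of \<open>A\<close> and
its rows in the left kernel, so they are multiples of \<open>y\<^sup>(\<^sup>q\<^sup>)\<close> and \<open>x\<close>. For a suitable
column and row the multiples are nonzero, so that \<open>\<beta>(y, x)\<^sup>q\<close> is, up to a nonzero factor, a
polynomial in the entries of \<open>A\<close> and of its adjugate, and thus in the entries of \<open>A\<close>.

It is dense, because it holds at \<open>W\<^sub>n\<^sub>-\<^sub>1\<close> and the rank locus is irreducible
(\<open>rank_locus_irreducible\<close>): any two matrices \<open>A = L B R\<close> and \<open>B\<close> of corank one are joined by the
polynomial curve \<open>L(t) B R(t)\<close> with \<open>L(t)\<close>, \<open>R(t)\<close> on the lines through the identity and \<open>L\<close>,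
\<open>R\<close>, and a regular function that is nonzero at one point of the curve vanishes at only finitely
many of its points.\<close>

(* The dollar sign stands for vector entries only, not for power series coefficients. *)
no_notation fps_nth (infixl \<open>$\<close> 75)

section \<open>Invertible matrices\<close>

lemma inverse_mat_exists:
  assumes A: "(A :: 'a::field mat) \<in> carrier_mat n n" and d: "det A \<noteq> 0"
  obtains B where "B \<in> carrier_mat n n" "A * B = 1\<^sub>m n" "B * A = 1\<^sub>m n" "det B \<noteq> 0"
proof -
  let ?B = "inverse (det A) \<cdot>\<^sub>m adj_mat A"
  note adj = adj_mat[OF A]
  have 1: "A * ?B = 1\<^sub>m n" "?B * A = 1\<^sub>m n"
    using adj A d by (auto simp: mult_smult_distrib mult_smult_assoc_mat[of _ n n])
  have c: "?B \<in> carrier_mat n n" using adj by auto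
  have "det A * det ?B = 1" using det_mult[OF A c] 1 by simp
  hence "det ?B \<noteq> 0" by auto
  thus ?thesis using that c 1 by blast
qed

lemma invertible_mat_iff_det_nonzero:
  assumes A: "(A :: 'a::field mat) \<in> carrier_mat n n"
  shows "invertible_mat A \<longleftrightarrow> det A \<noteq> 0"
proof
  assume "invertible_mat A"
  then obtain B where B: "A * B = 1\<^sub>m n" "B * A = 1\<^sub>m (dim_row B)"
    unfolding invertible_mat_def inverts_mat_def using A by auto
  have "dim_col (A * B) = n" unfolding B(1) by simp
  hence Bc: "dim_col B = n" by simp
  have "dim_col (B * A) = dim_row B" unfolding B(2) by simp
  hence "B \<in> carrier_mat n n" using A Bc by auto
  hence "det A * det B = 1" using B(1) det_mult[OF A] by (metis det_one)
  thus "det A \<noteq> 0" by auto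
next
  assume "det A \<noteq> 0"
  then obtain B where "B \<in> carrier_mat n n" "A * B = 1\<^sub>m n" "B * A = 1\<^sub>m n"
    using inverse_mat_exists[OF A] by blast
  thus "invertible_mat A"
    unfolding invertible_mat_def inverts_mat_def using A by auto
qed

lemma frob_equiv_iff_det:
  "frob_equiv N q A A' \<longleftrightarrow>
     (\<exists>T \<in> carrier_mat N N. det T \<noteq> 0 \<and> A' = transpose_mat T * A * frob_twist q T)"
  unfolding frob_equiv_def using invertible_mat_iff_det_nonzero by blast

text \<open>The columns are \<open>v\<close> and the standard basis without a vector \<open>e\<^sub>i\<close> such that \<open>v\<^sub>i \<noteq> 0\<close>.\<close>

lemma invertible_with_col:
  assumes v: "(v :: 'a::field vec) \<in> carrier_vec n" "v \<noteq> 0\<^sub>v n" and j: "j < n"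
  obtains G where "G \<in> carrier_mat n n" "det G \<noteq> 0" "col G j = v"
proof -
  obtain i where i: "i < n" "v $ i \<noteq> 0"
    using v by (metis carrier_vecD eq_vecI index_zero_vec(1,2))
  let ?G = "mat n n (\<lambda>(k, l). if l = j then v $ k
     else if l = i then (if k = j then 1 else 0) else if k = l then 1 else 0)"
  have G: "?G \<in> carrier_mat n n" by simp
  have "det ?G \<noteq> 0"
  proof
    assume "det ?G = 0"
    then obtain z where z: "z \<in> carrier_vec n" "z \<noteq> 0\<^sub>v n" "?G *\<^sub>v z = 0\<^sub>v n"
      using det_0_iff_vec_prod_zero[OF G] by blast
    have e: "(\<Sum>l<n. ?G $$ (k, l) * z $ l) = 0" if "k < n" for k
    proof -
      have "(?G *\<^sub>v z) $ k = (\<Sum>l<n. ?G $$ (k, l) * z $ l)"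
        using that z(1) by (auto simp: scalar_prod_def lessThan_atLeast0 intro!: sum.cong)
      thus ?thesis using z(3) that by simp
    qed
    have "(\<Sum>l<n. ?G $$ (i, l) * z $ l) = (\<Sum>l\<in>{j}. ?G $$ (i, l) * z $ l)"
      by (rule sum.mono_neutral_right) (use i j in auto)
    hence zj: "z $ j = 0" using e[of i] i j by simp
    have zl: "z $ l = 0" if l: "l < n" for l
    proof -
      let ?k = "if l = i then j else l"
      have "(\<Sum>h<n. ?G $$ (?k, h) * z $ h) = (\<Sum>h\<in>{l}. ?G $$ (?k, h) * z $ h)" if "l \<noteq> j"
        by (rule sum.mono_neutral_right) (use i j l zj that in \<open>auto split: if_splits\<close>)
      thus ?thesis using e[of ?k] l i j zj by (cases "l = j"; cases "l = i") auto
    qed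
    have "z = 0\<^sub>v n" using z(1) zl by auto
    with z(2) show False by blast
  qed
  moreover have "col ?G j = v" using v(1) j by auto
  ultimately show ?thesis using that G by blast
qed

section \<open>The Frobenius map on matrices\<close>

text \<open>Frobenius enters through the additivity of \<open>x \<mapsto> x\<^sup>q\<close> for an exponent greater than one. Stated
in this form the assumptions pass from \<open>q\<close> to \<open>q\<^sup>2\<close>: the orthonormal bases for the exponent \<open>q\<close>
come from Lang's theorem for \<open>q\<^sup>2\<close>.\<close>

locale frobenius =
  fixes ty :: "'a::alg_closed_field itself" and q :: nat
  assumes q_gt_1: "1 < q"
    and power_add: "\<And>x y :: 'a. (x + y) ^ q = x ^ q + y ^ q"
begin

sublocale hom: field_hom "\<lambda>x :: 'a. x ^ q"
  by unfold_locales (use q_gt_1 power_add in \<open>auto simp: power_mult_distrib\<close>)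

lemma frobenius_square: "frobenius TYPE('a) (q * q)"
  by unfold_locales (use q_gt_1 power_add less_1_mult[OF q_gt_1 q_gt_1] in \<open>auto simp: power_mult\<close>)

lemma frob_twist_carrier [simp]:
  "frob_twist q T \<in> carrier_mat r c \<longleftrightarrow> (T :: 'a mat) \<in> carrier_mat r c"
  by (auto simp: frob_twist_def)

lemma frob_twist_mult:
  "(A :: 'a mat) \<in> carrier_mat r m \<Longrightarrow> B \<in> carrier_mat m c \<Longrightarrow>
     frob_twist q (A * B) = frob_twist q A * frob_twist q B"
  unfolding frob_twist_def by (rule hom.mat_hom_mult)

lemma frob_twist_one [simp]: "frob_twist q (1\<^sub>m n :: 'a mat) = 1\<^sub>m n"
  unfolding frob_twist_def by (rule hom.mat_hom_one)

lemma frob_twist_zero [simp]: "frob_twist q (0\<^sub>m r c :: 'a mat) = 0\<^sub>m r c"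
  unfolding frob_twist_def by (rule eq_matI) auto

lemma frob_twist_transpose: "frob_twist q (transpose_mat T :: 'a mat) = transpose_mat (frob_twist q T)"
  unfolding frob_twist_def by (rule eq_matI) auto

lemma frob_twist_frob_twist: "frob_twist q (frob_twist q T) = frob_twist (q * q) (T :: 'a mat)"
  unfolding frob_twist_def by (rule eq_matI) (auto simp: power_mult)

lemma det_frob_twist: "det (frob_twist q T) = det (T :: 'a mat) ^ q"
  unfolding frob_twist_def by (rule hom.hom_det)

lemma frob_twist_four_block:
  assumes "(A :: 'a mat) \<in> carrier_mat r c" "B \<in> carrier_mat r c'"
    "C \<in> carrier_mat r' c" "D \<in> carrier_mat r' c'"
  shows "frob_twist q (four_block_mat A B C D)
    = four_block_mat (frob_twist q A) (frob_twist q B) (frob_twist q C) (frob_twist q D)"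
  unfolding frob_twist_def by (rule map_four_block_mat[OF assms])

lemma frob_equiv_trans:
  assumes A: "(A :: 'a mat) \<in> carrier_mat n n"
    and "frob_equiv n q A B" "frob_equiv n q B C"
  shows "frob_equiv n q A C"
proof -
  obtain S T where S: "S \<in> carrier_mat n n" "det S \<noteq> 0" "B = transpose_mat S * A * frob_twist q S"
    and T: "T \<in> carrier_mat n n" "det T \<noteq> 0" "C = transpose_mat T * B * frob_twist q T"
    using assms unfolding frob_equiv_iff_det by blast
  have "C = transpose_mat (S * T) * A * frob_twist q (S * T)"
    using A S(1) T(1) unfolding T(3) S(3)
    by (simp add: transpose_mult[of _ n n _ n] frob_twist_mult[of _ n n _ n] assoc_mult_mat[of _ n n _ n _ n])
  moreover have "det (S * T) \<noteq> 0" using S T det_mult[of S n T] by auto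
  ultimately show ?thesis unfolding frob_equiv_iff_det using mult_carrier_mat[OF S(1) T(1)] by blast
qed

lemma frob_equiv_block:
  assumes A: "(A :: 'a mat) \<in> carrier_mat m m" and B: "B \<in> carrier_mat k k"
    and "frob_equiv m q A A'" "frob_equiv k q B B'"
  shows "frob_equiv (m + k) q (four_block_mat A (0\<^sub>m m k) (0\<^sub>m k m) B)
                              (four_block_mat A' (0\<^sub>m m k) (0\<^sub>m k m) B')"
proof -
  obtain S T where S: "S \<in> carrier_mat m m" "det S \<noteq> 0" "A' = transpose_mat S * A * frob_twist q S"
    and T: "T \<in> carrier_mat k k" "det T \<noteq> 0" "B' = transpose_mat T * B * frob_twist q T"
    using assms unfolding frob_equiv_iff_det by blast
  let ?T = "four_block_mat S (0\<^sub>m m k) (0\<^sub>m k m) T"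
  have "det ?T \<noteq> 0" using S T by (subst det_four_block_mat_lower_left_zero) auto
  moreover have "four_block_mat A' (0\<^sub>m m k) (0\<^sub>m k m) B'
    = transpose_mat ?T * four_block_mat A (0\<^sub>m m k) (0\<^sub>m k m) B * frob_twist q ?T"
    using A B S(1) T(1) unfolding S(3) T(3)
    by (simp add: transpose_four_block_mat[of _ m m _ k _ k] frob_twist_four_block[of _ m m _ k _ k]
        mult_four_block_mat[of _ m m _ k _ k _ _ m _ k])
  ultimately show ?thesis unfolding frob_equiv_iff_det using S(1) T(1)
      four_block_carrier_mat[OF S(1) T(1)] by blast
qed

end

section \<open>Lang's theorem for the general linear group\<close>

text \<open>Padded by a zero row, \<open>m + 1\<close> columns of length \<open>m\<close> form a singular square matrix.\<close>

lemma linear_relation_exists: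
  fixes w :: "nat \<Rightarrow> 'a::field vec"
  obtains a i where "i \<le> m" "a i \<noteq> 0" "\<And>l. l < m \<Longrightarrow> (\<Sum>i\<le>m. a i * w i $ l) = 0"
proof -
  define M where "M = mat (Suc m) (Suc m) (\<lambda>(l, i). if l < m then w i $ l else 0)"
  have M: "M \<in> carrier_mat (Suc m) (Suc m)" by (simp add: M_def)
  hence Mt: "transpose_mat M \<in> carrier_mat (Suc m) (Suc m)" by simp
  have row: "row M m = 0\<^sub>v (Suc m)" by (rule eq_vecI) (auto simp: M_def)
  have "transpose_mat M *\<^sub>v unit_vec (Suc m) m = col (transpose_mat M) m"
    by (rule eq_vecI) (use Mt in auto)
  hence "transpose_mat M *\<^sub>v unit_vec (Suc m) m = 0\<^sub>v (Suc m)"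
    using row M by simp
  hence "det (transpose_mat M) = 0"
    using det_0_iff_vec_prod_zero[OF Mt] unit_vec_nonzero[of m "Suc m"] unit_vec_carrier by blast
  hence "det M = 0" using det_transpose[OF M] by simp
  then obtain z where z: "z \<in> carrier_vec (Suc m)" "z \<noteq> 0\<^sub>v (Suc m)" "M *\<^sub>v z = 0\<^sub>v (Suc m)"
    using det_0_iff_vec_prod_zero[OF M] by blast
  have "\<exists>i\<le>m. vec_index z i \<noteq> 0"
  proof (rule ccontr)
    assume "\<not> ?thesis"
    hence "z = 0\<^sub>v (Suc m)" using z(1) by (intro eq_vecI) auto
    with z(2) show False by blast
  qed
  then obtain i where i: "i \<le> m" "vec_index z i \<noteq> 0" by blast
  show ?thesis
  proof (rule that[of i "vec_index z"])
    fix l assume l: "l < m"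
    have "(M *\<^sub>v z) $ l = row M l \<bullet> z" using M l by simp
    also have "\<dots> = (\<Sum>i<Suc m. row M l $ i * z $ i)"
      using z(1) by (simp add: scalar_prod_def lessThan_atLeast0)
    also have "\<dots> = (\<Sum>i\<le>m. z $ i * w i $ l)"
      unfolding lessThan_Suc_atMost using l by (intro sum.cong) (auto simp: M_def)
    finally show "(\<Sum>i\<le>m. z $ i * w i $ l) = 0" using z(3) l by simp
  qed (rule i)+
qed

context frobenius
begin

lemma affine_equation_solution: "\<exists>x :: 'a. x ^ q + d * x = c"
proof -
  let ?p = "monom (1 :: 'a) q + [:-c, d:]"
  have "degree [:-c, d:] \<le> 1" by simp
  hence "degree [:-c, d:] < degree (monom (1 :: 'a) q)"
    using q_gt_1 by (simp add: degree_monom_eq)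
  hence "degree ?p = q" by (simp add: degree_add_eq_left degree_monom_eq)
  then obtain x where "poly ?p x = 0" using alg_closed_imp_poly_has_root[of ?p] q_gt_1 by auto
  thus ?thesis by (intro exI[of _ x]) (simp add: poly_monom algebra_simps)
qed

text \<open>If \<open>w\<^sub>0, \<dots>, w\<^sub>k\<close> is a basis on which a \<open>q\<close>-semilinear map acts by \<open>w\<^sub>j \<mapsto> w\<^sub>j\<^sub>+\<^sub>1\<close> and
\<open>w\<^sub>k \<mapsto> \<Sum> a\<^sub>j w\<^sub>j\<close>, these are the equations for \<open>\<Sum> x\<^sub>j w\<^sub>j\<close> to be fixed. They express every
\<open>x\<^sub>j\<close> as an additive polynomial in \<open>t = x\<^sub>k\<close> that is divisible by \<open>t\<^sup>q\<close>; only \<open>x\<^sub>k = t\<close> is left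
to solve, and \<open>t\<close> can be cancelled from it.\<close>

lemma cyclic_fixed_point:
  fixes a :: "nat \<Rightarrow> 'a"
  assumes "i \<le> k" "a i \<noteq> 0"
  obtains x where "x k \<noteq> 0" "x 0 = a 0 * x k ^ q"
    "\<And>j. x (Suc j) = x j ^ q + a (Suc j) * x k ^ q"
proof -
  define X where "X = rec_nat (monom (a 0) q) (\<lambda>i P. P ^ q + monom (a (Suc i)) q)"
  have X0: "X 0 = monom (a 0) q" and XS: "X (Suc j) = X j ^ q + monom (a (Suc j)) q" for j
    by (simp_all add: X_def)
  have m: "monom 1 q dvd monom c q" for c :: 'a
    by (rule dvdI[of _ _ "[:c:]"]) (simp add: smult_monom)
  have dv: "monom 1 q dvd X j" for j
  proof (induction j)
    case 0
    show ?case unfolding X0 by (rule m)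
  next
    case (Suc j)
    have "X j dvd X j ^ q" using q_gt_1 by (simp add: dvd_power)
    with Suc have "monom 1 q dvd X j ^ q" by (rule dvd_trans)
    thus ?case unfolding XS by (intro dvd_add m)
  qed
  have nz: "X j \<noteq> 0" if "i \<le> j" for j
    using that
  proof (induction j)
    case 0
    thus ?case using assms by (simp add: X0)
  next
    case (Suc j)
    show ?case
    proof (cases "X j = 0")
      case True
      hence "Suc j = i" using Suc by (cases "i \<le> j") auto
      thus ?thesis using True assms q_gt_1 XS[of j] by (auto simp: power_0_left)
    next
      case False
      \<comment> \<open>As \<open>X j\<close> has degree at least \<open>q\<close>, its \<open>q\<close>-th power cannot be cancelled by the new term.\<close>
      have "degree (monom (1 :: 'a) q) \<le> degree (X j)" by (rule dvd_imp_degree_le[OF dv False])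
      hence "q * q \<le> q * degree (X j)" by (simp add: degree_monom_eq)
      moreover have "degree (X j ^ q) = q * degree (X j)" by (rule degree_power_eq[OF False])
      moreover have "q * 1 < q * q" using q_gt_1 by (intro mult_strict_left_mono) auto
      moreover have "degree (monom (a (Suc j)) q) \<le> q" by (rule degree_monom_le)
      ultimately have "degree (monom (a (Suc j)) q) < degree (X j ^ q)" and "0 < degree (X j ^ q)"
        by linarith+
      hence "0 < degree (X (Suc j))" unfolding XS by (simp add: degree_add_eq_left)
      thus ?thesis by auto
    qed
  qed
  obtain Z where Z: "X k = monom 1 q * Z" using dv by (rule dvdE)
  hence Z0: "Z \<noteq> 0" using nz[OF assms(1)] by auto
  let ?p = "monom 1 (q - 1) * Z + [:-1:]"
  have "degree (monom 1 (q - 1) * Z) = q - 1 + degree Z"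
    using Z0 by (simp add: degree_mult_eq degree_monom_eq)
  hence "0 < degree ?p" using q_gt_1 by (simp add: degree_add_eq_left)
  then obtain t where "poly ?p t = 0" using alg_closed_imp_poly_has_root by blast
  hence t: "t ^ (q - 1) * poly Z t = 1" by (simp add: poly_monom)
  have "t ^ q = t * t ^ (q - 1)" using q_gt_1 by (cases q) auto
  hence "poly (X k) t = t * (t ^ (q - 1) * poly Z t)" by (simp add: Z poly_monom)
  hence "poly (X k) t = t" unfolding t by simp
  moreover have "t \<noteq> 0" using t q_gt_1 by (auto simp: power_0_left)
  ultimately show ?thesis
    using that[of "\<lambda>j. poly (X j) t"] by (simp add: X0 XS poly_monom poly_power)
qed

text \<open>Iterate the semilinear map \<open>\<phi> v = C v\<^sup>(\<^sup>q\<^sup>)\<close> on a nonzero vector and stop at the first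
linear dependence. The iterates before it span a space on which \<open>\<phi>\<close> acts like a companion
matrix, and \<open>cyclic_fixed_point\<close> applies, because \<open>\<phi>\<close> is injective, so that the last iterate is
not zero.\<close>

lemma fixed_vector:
  assumes C: "(C :: 'a mat) \<in> carrier_mat m m" "det C \<noteq> 0" and m: "0 < m"
  obtains v where "v \<in> carrier_vec m" "v \<noteq> 0\<^sub>v m" "C *\<^sub>v map_vec (\<lambda>x. x ^ q) v = v"
proof -
  define \<phi> where "\<phi> v = C *\<^sub>v map_vec (\<lambda>x. x ^ q) v" for v
  define w where "w i = (\<phi> ^^ i) (unit_vec m 0)" for i
  have w0: "w 0 = unit_vec m 0" and wS: "w (Suc i) = \<phi> (w i)" for i
    by (simp_all add: w_def)
  have wc: "w i \<in> carrier_vec m" for i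
    by (induction i) (use C in \<open>auto simp: w0 wS \<phi>_def\<close>)
  have \<phi>_nth: "\<phi> v $ l = (\<Sum>j<m. C $$ (l, j) * v $ j ^ q)" if "v \<in> carrier_vec m" "l < m" for v l
    using that C unfolding \<phi>_def by (auto simp: scalar_prod_def lessThan_atLeast0 intro!: sum.cong)
  have \<phi>0: "v = 0\<^sub>v m" if v: "v \<in> carrier_vec m" "\<phi> v = 0\<^sub>v m" for v
  proof -
    have "map_vec (\<lambda>x. x ^ q) v \<in> carrier_vec m" using v(1) by simp
    with v(2) have z: "map_vec (\<lambda>x. x ^ q) v = 0\<^sub>v m"
      using det_0_iff_vec_prod_zero[OF C(1)] C(2) unfolding \<phi>_def by blast
    have "v $ l ^ q = 0" if "l < m" for l
      using arg_cong[OF z, of "\<lambda>v. vec_index v l"] that v(1) by simp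
    thus ?thesis using v q_gt_1 by (intro eq_vecI) auto
  qed
  have wn0: "w i \<noteq> 0\<^sub>v m" for i
  proof (induction i)
    case 0
    show ?case unfolding w0 using m by (rule unit_vec_nonzero)
  next
    case (Suc i)
    thus ?case unfolding wS using \<phi>0[OF wc] by blast
  qed
  define dep where "dep k a \<longleftrightarrow> (\<exists>i\<le>k. a i \<noteq> 0) \<and> (\<forall>l<m. (\<Sum>i\<le>k. a i * w i $ l) = 0)"
    for k and a :: "nat \<Rightarrow> 'a"
  obtain a\<^sub>0 i\<^sub>0 where "i\<^sub>0 \<le> m" "a\<^sub>0 i\<^sub>0 \<noteq> 0" "\<And>l. l < m \<Longrightarrow> (\<Sum>i\<le>m. a\<^sub>0 i * w i $ l) = 0"
    using linear_relation_exists[of m w] by blast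
  hence "dep m a\<^sub>0" unfolding dep_def by blast
  hence "\<exists>k a. dep k a" by blast
  define k where "k = (LEAST k. \<exists>a. dep k a)"
  obtain a where a: "dep k a" using LeastI_ex[OF \<open>\<exists>k a. dep k a\<close>] unfolding k_def by blast
  have min: "\<not> dep j b" if "j < k" for j b
    using not_less_Least[of j "\<lambda>k. \<exists>a. dep k a"] that unfolding k_def by blast
  have "k \<noteq> 0"
  proof
    assume "k = 0"
    with a m have "a 0 \<noteq> 0" "a 0 * w 0 $ 0 = 0" unfolding dep_def by auto
    thus False using m by (simp add: w0)
  qed
  then obtain r where k: "k = Suc r" by (cases k) auto
  have ak: "a k \<noteq> 0"
  proof
    assume z: "a k = 0"
    \<comment> \<open>A relation without \<open>w\<^sub>k\<close> would contradict the minimality of \<open>k\<close>.\<close>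
    have "\<exists>i\<le>r. a i \<noteq> 0" using a z unfolding dep_def k by (metis le_Suc_eq)
    moreover have "(\<Sum>i\<le>r. a i * w i $ l) = 0" if "l < m" for l
      using a z that unfolding dep_def k by auto
    ultimately have "dep r a" unfolding dep_def by blast
    thus False using min[of r a] k by simp
  qed
  define b where "b i = - a i / a k" for i
  have wr: "w (Suc r) $ l = (\<Sum>i\<le>r. b i * w i $ l)" if "l < m" for l
  proof -
    have "(\<Sum>i\<le>r. a i * w i $ l) + a k * w k $ l = 0" using a that unfolding dep_def k by simp
    hence "w k $ l = - (\<Sum>i\<le>r. a i * w i $ l) / a k" using ak
      by (simp add: field_simps eq_neg_iff_add_eq_0 add.commute)
    also have "\<dots> = (\<Sum>i\<le>r. b i * w i $ l)"
      by (simp add: b_def sum_divide_distrib sum_negf[symmetric])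
    finally show ?thesis unfolding k .
  qed
  \<comment> \<open>Otherwise the iterate \<open>w\<^sub>r\<^sub>+\<^sub>1\<close> would vanish.\<close>
  have "\<exists>i\<le>r. b i \<noteq> 0"
  proof (rule ccontr)
    assume "\<not> ?thesis"
    hence "w (Suc r) = 0\<^sub>v m" using wc[of "Suc r"] wr by (intro eq_vecI) auto
    thus False using wn0 by blast
  qed
  then obtain i where i: "i \<le> r" "b i \<noteq> 0" by blast
  obtain x where x: "x r \<noteq> 0" "x 0 = b 0 * x r ^ q"
      "\<And>j. x (Suc j) = x j ^ q + b (Suc j) * x r ^ q"
    using cyclic_fixed_point[where a = b, OF i] by blast
  define v where "v = vec m (\<lambda>l. \<Sum>i\<le>r. x i * w i $ l)"
  have vc: "v \<in> carrier_vec m" by (simp add: v_def)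
  have "v \<noteq> 0\<^sub>v m"
  proof
    assume v0: "v = 0\<^sub>v m"
    have "(\<Sum>i\<le>r. x i * w i $ l) = 0" if "l < m" for l
      using arg_cong[OF v0, of "\<lambda>v. vec_index v l"] that by (simp add: v_def)
    hence "dep r x" using x(1) unfolding dep_def by blast
    thus False using min[of r x] k by simp
  qed
  moreover have "\<phi> v = v"
  proof (rule eq_vecI)
    fix l assume "l < dim_vec v"
    hence l: "l < m" by (simp add: v_def)
    have "\<phi> v $ l = (\<Sum>j<m. \<Sum>i\<le>r. C $$ (l, j) * (x i ^ q * w i $ j ^ q))"
      unfolding \<phi>_nth[OF vc l] by (simp add: v_def hom.hom_sum sum_distrib_left power_mult_distrib)
    also have "\<dots> = (\<Sum>i\<le>r. x i ^ q * w (Suc i) $ l)"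
      by (subst sum.swap) (simp add: wS \<phi>_nth[OF wc l] sum_distrib_left mult_ac)
    also have "\<dots> = (\<Sum>i<r. x i ^ q * w (Suc i) $ l) + x r ^ q * (\<Sum>i\<le>r. b i * w i $ l)"
      unfolding wr[OF l, symmetric] by (simp add: lessThan_Suc_atMost[symmetric])
    also have "\<dots> = (\<Sum>i\<le>r. x i * w i $ l)"
      unfolding sum.atMost_shift
      by (simp add: x(2,3) distrib_right sum.distrib distrib_left sum_distrib_left mult_ac)
    finally show "\<phi> v $ l = v $ l" using l by (simp add: v_def)
  qed (use C in \<open>simp add: \<phi>_def v_def\<close>)
  ultimately show ?thesis using that[of v] vc unfolding \<phi>_def by blast
qed

text \<open>Lang's theorem for the general linear group. Make a fixed vector of \<open>v \<mapsto> C v\<^sup>(\<^sup>q\<^sup>)\<close> the first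
basis vector; then \<open>C\<close> becomes block upper triangular with first diagonal entry 1. The lower block
is handled by induction, and the first row of the solution by the Artin-Schreier equations
\<open>x\<^sup>q + s = x\<close>.\<close>

lemma lang_general_linear:
  assumes "(C :: 'a mat) \<in> carrier_mat m m" "det C \<noteq> 0"
  shows "\<exists>T \<in> carrier_mat m m. det T \<noteq> 0 \<and> C * frob_twist q T = T"
  using assms
proof (induction m arbitrary: C)
  case 0
  show ?case by (rule bexI[of _ "1\<^sub>m 0"]) (use 0 in \<open>auto intro!: eq_matI\<close>)
next
  case (Suc m C)
  note C = Suc.prems(1)
  obtain v where v: "v \<in> carrier_vec (Suc m)" "v \<noteq> 0\<^sub>v (Suc m)" "C *\<^sub>v map_vec (\<lambda>x. x ^ q) v = v"
    using fixed_vector[OF Suc.prems] by blast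
  obtain P where P: "P \<in> carrier_mat (Suc m) (Suc m)" "det P \<noteq> 0" "col P 0 = v"
    using invertible_with_col[OF v(1,2), of 0] by blast
  obtain R where R: "R \<in> carrier_mat (Suc m) (Suc m)" "P * R = 1\<^sub>m (Suc m)" "R * P = 1\<^sub>m (Suc m)" "det R \<noteq> 0"
    using inverse_mat_exists[OF P(1,2)] by blast
  have tP: "frob_twist q P \<in> carrier_mat (Suc m) (Suc m)" using P by simp
  define D where "D = R * (C * frob_twist q P)"
  have Dc: "D \<in> carrier_mat (Suc m) (Suc m)" using C P R by (simp add: D_def)
  have "col (frob_twist q P) 0 = map_vec (\<lambda>x. x ^ q) v"
    using P unfolding P(3)[symmetric] frob_twist_def by (intro eq_vecI) auto
  hence "col (C * frob_twist q P) 0 = v" using v(3) by (subst col_mult2[OF C tP]) auto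
  hence "col D 0 = R *\<^sub>v v" unfolding D_def using mult_carrier_mat[OF C tP]
    by (subst col_mult2[OF R(1)]) auto
  also have "\<dots> = col (R * P) 0" using P by (subst col_mult2[OF R(1) P(1)]) auto
  finally have D0: "col D 0 = unit_vec (Suc m) 0" by (simp add: R(3))
  define r where "r = mat 1 m (\<lambda>(i, j). D $$ (0, Suc j))"
  define E where "E = mat m m (\<lambda>(i, j). D $$ (Suc i, Suc j))"
  have rE: "r \<in> carrier_mat 1 m" "E \<in> carrier_mat m m" by (simp_all add: r_def E_def)
  have Di0: "D $$ (i, 0) = (if i = 0 then 1 else 0)" if "i < Suc m" for i
    using arg_cong[OF D0, of "\<lambda>v. vec_index v i"] that Dc by auto
  have D: "D = four_block_mat (1\<^sub>m 1) r (0\<^sub>m m 1) E"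
    by (rule eq_matI) (use Dc Di0 in \<open>auto simp: r_def E_def\<close>)
  have "det D = det R * (det C * det P ^ q)"
    unfolding D_def using C P R tP by (simp add: det_mult[of _ "Suc m"] det_frob_twist)
  moreover have "det D = det E" unfolding D using rE
    by (subst det_four_block_mat_lower_left_zero) auto
  ultimately have "det E \<noteq> 0" using R(4) Suc.prems(2) P(2) by auto
  from Suc.IH[OF rE(2) this] obtain T where T: "T \<in> carrier_mat m m" "det T \<noteq> 0" "E * frob_twist q T = T"
    by blast
  define s where "s = r * frob_twist q T"
  have "\<exists>y. y ^ q + s $$ (0, j) = y" for j
    using affine_equation_solution[of "-1" "- s $$ (0, j)"] by (auto simp: algebra_simps)
  then obtain f where f: "\<And>j. f j ^ q + s $$ (0, j) = f j" by metis
  define x where "x = mat 1 m (\<lambda>(i, j). f j)"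
  have sx: "s \<in> carrier_mat 1 m" "x \<in> carrier_mat 1 m" using rE T by (simp_all add: s_def x_def)
  have xs: "frob_twist q x + s = x"
    by (rule eq_matI) (use sx f in \<open>auto simp: x_def frob_twist_def\<close>)
  define T2 where "T2 = four_block_mat (1\<^sub>m 1) x (0\<^sub>m m 1) T"
  have T2c: "T2 \<in> carrier_mat (Suc m) (Suc m)" using T sx unfolding T2_def by auto
  have "D * frob_twist q T2 = four_block_mat (1\<^sub>m 1) (frob_twist q x + s) (0\<^sub>m m 1) (E * frob_twist q T)"
    unfolding D T2_def s_def using rE T(1) sx
    by (simp add: frob_twist_four_block[of _ 1 1 _ m _ m] mult_four_block_mat[of _ 1 1 _ m _ m _ _ 1 _ m])
  hence DT: "D * frob_twist q T2 = T2" unfolding xs T(3) T2_def .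
  have "det T2 = det T" unfolding T2_def using T sx
    by (subst det_four_block_mat_lower_left_zero) auto
  hence "det (P * T2) \<noteq> 0" using T(2) P(2) det_mult[OF P(1) T2c] by auto
  moreover have "C * frob_twist q (P * T2) = P * T2"
  proof -
    have tT: "frob_twist q T2 \<in> carrier_mat (Suc m) (Suc m)" using T2c by simp
    note as = assoc_mult_mat[of _ "Suc m" "Suc m" _ "Suc m" _ "Suc m"]
    have "C * frob_twist q (P * T2) = (P * R) * (C * (frob_twist q P * frob_twist q T2))"
      using C T2c tP tT by (simp add: R(2) frob_twist_mult[OF P(1) T2c])
    also have "\<dots> = P * (D * frob_twist q T2)"
      unfolding D_def using P(1) R(1) C tP tT by (simp add: as)
    finally show ?thesis unfolding DT .
  qed
  ultimately show ?case using mult_carrier_mat[OF P(1) T2c] by blast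
qed

end

section \<open>Nondegenerate Frobenius forms\<close>

lemma four_block_cases:
  assumes A: "A \<in> carrier_mat (m + k) (m + k)"
  obtains D U V B where "D \<in> carrier_mat m m" "U \<in> carrier_mat m k" "V \<in> carrier_mat k m"
    "B \<in> carrier_mat k k" "A = four_block_mat D U V B"
proof -
  obtain D U V B where s: "split_block A m m = (D, U, V, B)" by (cases "split_block A m m")
  from split_block[OF s, of k k] A show ?thesis by (intro that[of D U V B]) auto
qed

context frobenius
begin

definition frob_form :: "'a mat \<Rightarrow> 'a vec \<Rightarrow> 'a vec \<Rightarrow> 'a" where
  "frob_form B v w = v \<bullet> (B *\<^sub>v map_vec (\<lambda>x. x ^ q) w)"

lemma index_frob_congruence:
  assumes "B \<in> carrier_mat n n" "T \<in> carrier_mat n n" "i < n" "j < n"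
  shows "(transpose_mat T * B * frob_twist q T) $$ (i, j) = frob_form B (col T i) (col T j)"
proof -
  have T: "frob_twist q T \<in> carrier_mat n n" using assms by simp
  have c: "col (frob_twist q T) j = map_vec (\<lambda>x. x ^ q) (col T j)"
    using assms by (intro eq_vecI) (auto simp: frob_twist_def)
  have "transpose_mat T * B * frob_twist q T = transpose_mat T * (B * frob_twist q T)"
    using assms T by (intro assoc_mult_mat) auto
  also have "\<dots> $$ (i, j) = col T i \<bullet> col (B * frob_twist q T) j"
    using assms T by simp
  also have "col (B * frob_twist q T) j = B *\<^sub>v col (frob_twist q T) j"
    using assms T by (intro col_mult2) auto
  finally show ?thesis unfolding frob_form_def c .
qed

text \<open>Hermitian symmetry for a vector \<open>v\<close> that is rational over the field with \<open>q\<^sup>2\<close> elements and an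
arbitrary \<open>w\<close>: the left and the right orthogonal complement of \<open>v\<close> agree.\<close>

lemma frob_form_swap:
  assumes B: "B \<in> carrier_mat n n" "transpose_mat B = frob_twist q B"
    and v: "v \<in> carrier_vec n" "\<And>l. l < n \<Longrightarrow> v $ l ^ (q * q) = v $ l" and w: "w \<in> carrier_vec n"
  shows "frob_form B v w = frob_form B w v ^ q"
proof -
  let ?F = "map_vec (\<lambda>x :: 'a. x ^ q)"
  have sp: "(x \<bullet> y) ^ q = ?F x \<bullet> ?F y" if "x \<in> carrier_vec n" "y \<in> carrier_vec n" for x y
    using that by (auto simp: scalar_prod_def hom.hom_sum power_mult_distrib intro!: sum.cong)
  have FF: "?F (?F v) = v" using v by (intro eq_vecI) (auto simp: power_mult)
  have "frob_form B w v ^ q = ?F w \<bullet> ?F (B *\<^sub>v ?F v)"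
    unfolding frob_form_def using B(1) v(1) w by (intro sp) auto
  also have "?F (B *\<^sub>v ?F v) = map_mat (\<lambda>x. x ^ q) B *\<^sub>v ?F (?F v)"
    using B(1) v(1) by (intro hom.mult_mat_vec_hom) auto
  also have "\<dots> = transpose_mat B *\<^sub>v v" unfolding FF B(2) frob_twist_def ..
  also have "?F w \<bullet> (transpose_mat B *\<^sub>v v) = (transpose_mat B *\<^sub>v v) \<bullet> ?F w"
    using B(1) v(1) w by (intro comm_scalar_prod[of _ n]) auto
  also have "\<dots> = v \<bullet> (B *\<^sub>v ?F w)"
    using B(1) v(1) w by (intro transpose_vec_mult_scalar) auto
  finally show ?thesis unfolding frob_form_def ..
qed

lemma frob_form_units:
  assumes "B \<in> carrier_mat n n" "i < n" "j < n"
  shows "frob_form B (unit_vec n i) (unit_vec n j) = B $$ (i, j)"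
proof -
  have "map_vec (\<lambda>x. x ^ q) (unit_vec n j) = (unit_vec n j :: 'a vec)"
    using assms q_gt_1 by (intro eq_vecI) auto
  thus ?thesis using assms by (simp add: frob_form_def)
qed

lemma frob_form_add_smult:
  assumes B: "B \<in> carrier_mat n n" and v: "v \<in> carrier_vec n" and w: "w \<in> carrier_vec n"
  shows "frob_form B (v + a \<cdot>\<^sub>v w) (v + a \<cdot>\<^sub>v w)
    = frob_form B v v + a ^ q * frob_form B v w + a * frob_form B w v + a * a ^ q * frob_form B w w"
proof -
  let ?F = "map_vec (\<lambda>x :: 'a. x ^ q)"
  have F: "?F (v + a \<cdot>\<^sub>v w) = ?F v + a ^ q \<cdot>\<^sub>v ?F w"
    using v w by (intro eq_vecI) (auto simp: power_add power_mult_distrib)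
  have c: "?F v \<in> carrier_vec n" "?F w \<in> carrier_vec n" using v w by auto
  hence d: "B *\<^sub>v ?F v \<in> carrier_vec n" "B *\<^sub>v ?F w \<in> carrier_vec n" using B by auto
  have "B *\<^sub>v (?F v + a ^ q \<cdot>\<^sub>v ?F w) = B *\<^sub>v ?F v + a ^ q \<cdot>\<^sub>v (B *\<^sub>v ?F w)"
    using B c by (simp add: mult_add_distrib_mat_vec[OF B] mult_mat_vec[OF B])
  thus ?thesis unfolding frob_form_def F using v w d
    by (simp add: add_scalar_prod_distrib[of _ n] scalar_prod_add_distrib[of _ n]
        smult_scalar_prod_distrib[of _ n] scalar_prod_smult_distrib[of _ n] algebra_simps)
qed

text \<open>The condition on \<open>v\<close> says that its entries lie in the field with \<open>q\<^sup>2\<close> elements. If all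
diagonal entries of \<open>B\<close> vanish, then \<open>v = e\<^sub>i + a e\<^sub>j\<close> has \<open>\<beta>(v, v) = b + b\<^sup>q\<close> with
\<open>b = a B\<^sub>j\<^sub>i\<close>, and the trace \<open>b \<mapsto> b + b\<^sup>q\<close> takes the value 1 on the field with \<open>q\<^sup>2\<close> elements.\<close>

lemma hermitian_anisotropic_vector:
  assumes B: "B \<in> carrier_mat n n" "transpose_mat B = frob_twist q B"
    and ij: "i < n" "j < n" "B $$ (i, j) \<noteq> 0"
  shows "\<exists>v \<in> carrier_vec n. (\<forall>l<n. v $ l ^ (q * q) = v $ l) \<and> frob_form B v v \<noteq> 0"
proof (cases "\<exists>l<n. B $$ (l, l) \<noteq> 0")
  case True
  then obtain l where l: "l < n" "B $$ (l, l) \<noteq> 0" by blast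
  have "unit_vec n l $ k ^ (q * q) = (unit_vec n l $ k :: 'a)" if "k < n" for k
    using l that q_gt_1 by simp
  thus ?thesis using l frob_form_units[OF B(1) l(1) l(1)]
    by (intro bexI[of _ "unit_vec n l"]) auto
next
  case False
  have h: "B $$ (l, k) = B $$ (k, l) ^ q" if "k < n" "l < n" for k l
    using arg_cong[OF B(2), of "\<lambda>M. M $$ (k, l)"] that B(1) by (simp add: frob_twist_def)
  obtain b :: 'a where "b ^ q + 1 * b = 1" using affine_equation_solution by blast
  hence b: "b ^ q = 1 - b" by (simp add: algebra_simps)
  define a where "a = b / B $$ (j, i)"
  have ji: "B $$ (j, i) \<noteq> 0" using h[of j i] ij q_gt_1 by auto
  have "b ^ (q * q) = (1 - b) ^ q" by (simp only: power_mult b)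
  also have "\<dots> = 1 - b ^ q" by (simp add: hom.hom_minus)
  also have "\<dots> = b" unfolding b by simp
  finally have "b ^ (q * q) = b" .
  moreover have "B $$ (j, i) ^ (q * q) = B $$ (j, i)"
    using h[of j i] h[of i j] ij by (simp add: power_mult)
  ultimately have aQ: "a ^ (q * q) = a" by (simp add: a_def power_divide)
  define v where "v = unit_vec n i + a \<cdot>\<^sub>v unit_vec n j"
  have "v $ l ^ (q * q) = v $ l" if "l < n" for l
    using that ij aQ q_gt_1 False by (auto simp: v_def)
  moreover have "frob_form B v v = a ^ q * B $$ (i, j) + a * B $$ (j, i)"
    unfolding v_def using False ij by (subst frob_form_add_smult[OF B(1)]) (auto simp: frob_form_units[OF B(1)])
  moreover have "\<dots> = b ^ q + b" using ji ij h[of j i] by (simp add: a_def power_divide)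
  ultimately show ?thesis using b by (intro bexI[of _ v]) (auto simp: v_def)
qed

text \<open>One congruence clears both off-diagonal blocks when a single \<open>X\<close> solves the linear equation for
\<open>U\<close> and the semilinear equation for \<open>V\<close>. The lower right block may be singular; it will be both
a Hermitian pivot and the pairing of two radicals.\<close>

lemma frob_equiv_block_diagonal:
  assumes D: "(D :: 'a mat) \<in> carrier_mat m m" and U: "U \<in> carrier_mat m k" and V: "V \<in> carrier_mat k m"
    and B: "B \<in> carrier_mat k k" and X: "X \<in> carrier_mat k m"
    and XU: "U + transpose_mat X * B = 0\<^sub>m m k" and XV: "V + B * frob_twist q X = 0\<^sub>m k m"
  shows "frob_equiv (m + k) q (four_block_mat D U V B)
    (four_block_mat (D + transpose_mat X * V) (0\<^sub>m m k) (0\<^sub>m k m) B)"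
proof -
  let ?T = "four_block_mat (1\<^sub>m m) (0\<^sub>m m k) X (1\<^sub>m k)"
  have "det ?T = 1" using X by (subst det_four_block_mat_upper_right_zero) auto
  moreover have tT: "transpose_mat ?T = four_block_mat (1\<^sub>m m) (transpose_mat X) (0\<^sub>m k m) (1\<^sub>m k)"
    using X by (subst transpose_four_block_mat[of _ m m _ k _ k]) auto
  moreover have "transpose_mat ?T * four_block_mat D U V B =
      four_block_mat (D + transpose_mat X * V) (0\<^sub>m m k) V B"
    unfolding tT using D U V B X XU
    by (subst mult_four_block_mat[of _ m m _ k _ k _ _ m _ k]) auto
  moreover have "frob_twist q ?T = four_block_mat (1\<^sub>m m) (0\<^sub>m m k) (frob_twist q X) (1\<^sub>m k)"
    using X by (subst frob_twist_four_block[of _ m m _ k _ k]) auto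
  hence "four_block_mat (D + transpose_mat X * V) (0\<^sub>m m k) V B * frob_twist q ?T
     = four_block_mat (D + transpose_mat X * V) (0\<^sub>m m k) (0\<^sub>m k m) B"
    using D U V B X XV
    by (simp only:) (subst mult_four_block_mat[of _ m m _ k _ k _ _ m _ k], auto)
  ultimately show ?thesis unfolding frob_equiv_iff_det
    by (intro bexI[of _ ?T]) (use X in auto)
qed

lemma det_frob_equiv:
  assumes "(A :: 'a mat) \<in> carrier_mat n n" "frob_equiv n q A B" "det A \<noteq> 0"
  shows "det B \<noteq> 0" "B \<in> carrier_mat n n"
proof -
  obtain T where T: "T \<in> carrier_mat n n" "det T \<noteq> 0" "B = transpose_mat T * A * frob_twist q T"
    using assms unfolding frob_equiv_iff_det by blast
  have c: "transpose_mat T * A \<in> carrier_mat n n" "frob_twist q T \<in> carrier_mat n n"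
    using T(1) assms(1) by auto
  have "det B = det T * det A * det T ^ q" unfolding T(3) det_mult[OF c]
    using T(1) assms(1) by (simp add: det_mult[of _ n] det_transpose[of _ n] det_frob_twist)
  thus "det B \<noteq> 0" using T(2) assms(3) by simp
  show "B \<in> carrier_mat n n" using T(1,3) assms(1) by auto
qed

text \<open>With \<open>H = T\<^sup>T B T\<^sup>(\<^sup>q\<^sup>)\<close> the equation \<open>H\<^sup>T = H\<^sup>(\<^sup>q\<^sup>)\<close> follows from
\<open>B\<^sup>(\<^sup>q\<^sup>) T\<^sup>(\<^sup>q\<^sup>2\<^sup>) = B\<^sup>T T\<close>, which is Lang's equation for \<open>B\<^sup>-\<^sup>T B\<^sup>(\<^sup>q\<^sup>)\<close> and the exponent
\<open>q\<^sup>2\<close>.\<close>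

lemma frob_equiv_hermitian:
  assumes B: "(B :: 'a mat) \<in> carrier_mat n n" "det B \<noteq> 0"
  obtains H where "frob_equiv n q B H" "H \<in> carrier_mat n n" "det H \<noteq> 0"
    "transpose_mat H = frob_twist q H"
proof -
  interpret Q: frobenius "TYPE('a)" "q * q" by (rule frobenius_square)
  note as = assoc_mult_mat[of _ n n _ n _ n]
  let ?Bt = "transpose_mat B"
  have Bt: "?Bt \<in> carrier_mat n n" "det ?Bt \<noteq> 0" using B det_transpose[OF B(1)] by auto
  obtain R where R: "R \<in> carrier_mat n n" "?Bt * R = 1\<^sub>m n" "R * ?Bt = 1\<^sub>m n" "det R \<noteq> 0"
    using inverse_mat_exists[OF Bt] by blast
  have tB: "frob_twist q B \<in> carrier_mat n n" "det (frob_twist q B) \<noteq> 0"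
    using B by (auto simp: det_frob_twist)
  have "det (R * frob_twist q B) \<noteq> 0" using R tB det_mult[OF R(1) tB(1)] by simp
  then obtain T where T: "T \<in> carrier_mat n n" "det T \<noteq> 0"
      "R * frob_twist q B * frob_twist (q * q) T = T"
    using Q.lang_general_linear[OF mult_carrier_mat[OF R(1) tB(1)]] by blast
  have tT: "frob_twist q T \<in> carrier_mat n n" "frob_twist (q * q) T \<in> carrier_mat n n" using T by simp_all
  have "?Bt * (R * frob_twist q B * frob_twist (q * q) T)
      = (?Bt * R) * (frob_twist q B * frob_twist (q * q) T)"
    using Bt(1) R(1) tB(1) tT by (simp add: as)
  \<comment> \<open>Lang's equation with the inverse of \<open>B\<^sup>T\<close> moved to the other side.\<close>
  hence e: "frob_twist q B * frob_twist (q * q) T = ?Bt * T"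
    unfolding T(3) R(2) using tB(1) tT by simp
  define H where "H = transpose_mat T * B * frob_twist q T"
  have "frob_equiv n q B H" unfolding frob_equiv_iff_det H_def using T by blast
  moreover have "transpose_mat H = frob_twist q H"
  proof -
    have "frob_twist q H = transpose_mat (frob_twist q T) * (frob_twist q B * frob_twist (q * q) T)"
      unfolding H_def using T(1) B(1) tB(1) tT
      by (simp add: frob_twist_mult[of _ n n _ n] frob_twist_transpose frob_twist_frob_twist as)
    also have "\<dots> = transpose_mat H" unfolding e H_def using T(1) B(1) tT Bt(1)
      by (simp add: transpose_mult[of _ n n _ n])
    finally show ?thesis ..
  qed
  ultimately show ?thesis using that det_frob_equiv[OF B(1) _ B(2)] by blast
qed

text \<open>A Hermitian Gram matrix lets one split off an anisotropic vector. The complement need not be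
Hermitian in the basis chosen here, so the induction makes it Hermitian anew.\<close>

theorem nondegenerate_frob_equiv_one:
  assumes "(B :: 'a mat) \<in> carrier_mat m m" "det B \<noteq> 0"
  shows "frob_equiv m q B (1\<^sub>m m)"
  using assms
proof (induction m arbitrary: B)
  case 0
  thus ?case unfolding frob_equiv_iff_det by (intro bexI[of _ "1\<^sub>m 0"]) (auto intro!: eq_matI)
next
  case (Suc m B)
  obtain H where H: "frob_equiv (Suc m) q B H" "H \<in> carrier_mat (Suc m) (Suc m)" "det H \<noteq> 0"
    "transpose_mat H = frob_twist q H"
    using frob_equiv_hermitian[OF Suc.prems] by blast
  have "\<exists>i<Suc m. \<exists>j<Suc m. H $$ (i, j) \<noteq> 0"
  proof (rule ccontr)
    assume "\<not> ?thesis"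
    hence "H *\<^sub>v unit_vec (Suc m) 0 = 0\<^sub>v (Suc m)" using H(2) by (intro eq_vecI) auto
    hence "det H = 0"
      using det_0_iff_vec_prod_zero[OF H(2)] unit_vec_nonzero[of 0 "Suc m"] unit_vec_carrier by blast
    thus False using H(3) by simp
  qed
  then obtain v where v: "v \<in> carrier_vec (Suc m)" "\<And>l. l < Suc m \<Longrightarrow> v $ l ^ (q * q) = v $ l"
      "frob_form H v v \<noteq> 0"
    using hermitian_anisotropic_vector[OF H(2,4)] by blast
  define b where "b = frob_form H v v"
  \<comment> \<open>The pivot lies in the field with \<open>q\<close> elements, so one \<open>X\<close> clears the row and the column.\<close>
  have bq: "b = b ^ q" unfolding b_def by (rule frob_form_swap[OF H(2,4) v(1,2) v(1)])
  have "frob_form H (0\<^sub>v (Suc m)) (0\<^sub>v (Suc m)) = 0"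
    using H(2) unfolding frob_form_def by (intro scalar_prod_left_zero) auto
  hence "v \<noteq> 0\<^sub>v (Suc m)" using v(3) by auto
  then obtain G where G: "G \<in> carrier_mat (Suc m) (Suc m)" "det G \<noteq> 0" "col G m = v"
    using invertible_with_col[OF v(1), of m] by blast
  define C where "C = transpose_mat G * H * frob_twist q G"
  have HC: "frob_equiv (Suc m) q H C" unfolding frob_equiv_iff_det C_def using G by blast
  note dC = det_frob_equiv[OF H(2) HC H(3)]
  have C_nth: "C $$ (i, j) = frob_form H (col G i) (col G j)" if "i < Suc m" "j < Suc m" for i j
    unfolding C_def using H(2) G(1) that by (rule index_frob_congruence)
  have Csym: "C $$ (m, j) = C $$ (j, m) ^ q" if "j < Suc m" for j
    using frob_form_swap[OF H(2,4) v(1,2), of "col G j"] that G by (simp add: C_nth)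
  have "C \<in> carrier_mat (m + 1) (m + 1)" using dC(2) by simp
  then obtain D U V E where bl: "D \<in> carrier_mat m m" "U \<in> carrier_mat m 1" "V \<in> carrier_mat 1 m"
      "E \<in> carrier_mat 1 1" "C = four_block_mat D U V E"
    using four_block_cases[of C m 1] by blast
  have Ub: "U $$ (j, 0) = C $$ (j, m)" and Vb: "V $$ (0, j) = C $$ (m, j)" if "j < m" for j
    using that bl(1-4) unfolding bl(5) by auto
  have Eb: "E $$ (0, 0) = b" using C_nth[of m m] bl(1-4) G(3) unfolding bl(5) b_def by auto
  define X where "X = mat 1 m (\<lambda>(i, j). - (C $$ (j, m) / b))"
  have X: "X \<in> carrier_mat 1 m" by (simp add: X_def)
  have b0: "b \<noteq> 0" using v(3) by (simp add: b_def)
  have XU: "U + transpose_mat X * E = 0\<^sub>m m 1"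
    using bl(1-4) X b0 Eb Ub by (intro eq_matI) (auto simp: X_def scalar_prod_def)
  have XV: "V + E * frob_twist q X = 0\<^sub>m 1 m"
    using bl(1-4) X b0 Eb Vb Csym bq[symmetric]
    by (intro eq_matI) (auto simp: X_def scalar_prod_def frob_twist_def power_divide hom.hom_uminus)
  define D' where "D' = D + transpose_mat X * V"
  have D': "D' \<in> carrier_mat m m" using bl X by (simp add: D'_def)
  have CD: "frob_equiv (Suc m) q C (four_block_mat D' (0\<^sub>m m 1) (0\<^sub>m 1 m) E)"
    using frob_equiv_block_diagonal[OF bl(1-4) X XU XV] unfolding bl(5) D'_def by simp
  have "det (four_block_mat D' (0\<^sub>m m 1) (0\<^sub>m 1 m) E) \<noteq> 0"
    by (rule det_frob_equiv[OF dC(2) CD dC(1)])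
  hence "det D' \<noteq> 0" using D' bl(4) by (subst (asm) det_four_block_mat_lower_left_zero) auto
  hence D1: "frob_equiv m q D' (1\<^sub>m m)" by (rule Suc.IH[OF D'])
  \<comment> \<open>Scaling a vector by \<open>c\<close> multiplies its value \<open>b\<close> by \<open>c\<^sup>q\<^sup>+\<^sup>1\<close>.\<close>
  obtain c where c: "c ^ Suc q = inverse b" using nth_root_exists[of "Suc q" "inverse b"] by auto
  have E1: "frob_equiv 1 q E (1\<^sub>m 1)"
    unfolding frob_equiv_iff_det
  proof (intro bexI[of _ "c \<cdot>\<^sub>m 1\<^sub>m 1"] conjI)
    have "c \<noteq> 0" using c b0 by auto
    thus "det (c \<cdot>\<^sub>m 1\<^sub>m 1) \<noteq> 0" by simp
    have "c * b * c ^ q = 1" using c b0 by (simp add: field_simps)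
    thus "1\<^sub>m 1 = transpose_mat (c \<cdot>\<^sub>m 1\<^sub>m 1) * E * frob_twist q (c \<cdot>\<^sub>m 1\<^sub>m 1)"
      using bl(4) Eb by (intro eq_matI) (auto simp: scalar_prod_def frob_twist_def)
  qed simp
  have "frob_equiv (Suc m) q (four_block_mat D' (0\<^sub>m m 1) (0\<^sub>m 1 m) E) (1\<^sub>m (Suc m))"
    using frob_equiv_block[OF D' bl(4) D1 E1] by (simp add: four_block_one_mat)
  thus ?case using frob_equiv_trans Suc.prems(1) H(1,2) HC dC(2) CD by blast
qed

end

section \<open>Matrices of corank one\<close>

lemma rank_plus_kernel_dim:
  assumes A: "(A :: 'a::field mat) \<in> carrier_mat n nc"
  shows "vec_space.rank n A + kernel.dim nc A = nc"
proof -
  interpret V: vec_space "TYPE('a)" nc .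
  interpret W: vec_space "TYPE('a)" n .
  interpret L: linear_map class_ring V.V W.V "\<lambda>v. A *\<^sub>v v"
    by unfold_locales
      (use A in \<open>auto simp: module_hom_def mult_add_distrib_mat_vec[OF A] mult_mat_vec[OF A]\<close>)
  have im: "L.imT = W.span (set (cols A))"
    unfolding L.im_def W.col_space_eq[OF A, unfolded W.col_space_def] using A by auto
  have ker: "L.kerT = mat_kernel A"
    unfolding L.ker_def mat_kernel_def using A by auto
  show ?thesis
    using L.rank_nullity[OF V.fin_dim] unfolding im ker W.rank_def V.dim_is_n .
qed

lemma kernel_vectors_proportional:
  assumes A: "(A :: 'a::field mat) \<in> carrier_mat (Suc n) (Suc n)" and r: "vec_space.rank (Suc n) A = n"
    and v: "v \<in> carrier_vec (Suc n)" "A *\<^sub>v v = 0\<^sub>v (Suc n)" "v \<noteq> 0\<^sub>v (Suc n)"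
    and w: "w \<in> carrier_vec (Suc n)" "A *\<^sub>v w = 0\<^sub>v (Suc n)"
  shows "\<exists>c. w = c \<cdot>\<^sub>v v"
proof -
  interpret K: kernel "Suc n" "Suc n" A by unfold_locales (rule A)
  have d: "K.dim = 1" using rank_plus_kernel_dim[OF A] r by simp
  obtain B where B: "finite B" "K.basis B" using kernel_basis_exists[OF A] by blast
  hence "card B = 1" using K.Ker.dim_basis d by simp
  then obtain b where b: "B = {b}" by (auto simp: card_1_singleton_iff)
  have bk: "b \<in> mat_kernel A" and sp: "K.span {b} = mat_kernel A"
    using B(2) unfolding K.Ker.basis_def b by auto
  hence bc: "b \<in> carrier_vec (Suc n)" using mat_kernel_carrier[OF A] by blast
  have *: "\<exists>c. z = c \<cdot>\<^sub>v b" if "z \<in> carrier_vec (Suc n)" "A *\<^sub>v z = 0\<^sub>v (Suc n)" for z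
  proof -
    have "z \<in> K.span {b}" unfolding sp using mat_kernelI[OF A that] .
    then obtain a where "z = K.lincomb a {b}"
      using K.Ker.finite_in_span[of "{b}" z] bk by auto
    thus ?thesis using bc bk by (auto simp: K.Ker.lincomb_def)
  qed
  obtain c d where cd: "v = c \<cdot>\<^sub>v b" "w = d \<cdot>\<^sub>v b" using * v w by meson
  hence "c \<noteq> 0" using v bc by auto
  hence "w = (d / c) \<cdot>\<^sub>v v" unfolding cd by (simp add: smult_smult_assoc)
  thus ?thesis ..
qed

lemma rank_mult_invertible:
  assumes A: "(A :: 'a::field mat) \<in> carrier_mat n n"
    and L: "L \<in> carrier_mat n n" "det L \<noteq> 0" and R: "R \<in> carrier_mat n n" "det R \<noteq> 0"
  shows "vec_space.rank n (L * A * R) = vec_space.rank n A"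
proof -
  obtain L' where L': "L' \<in> carrier_mat n n" "L' * L = 1\<^sub>m n" using inverse_mat_exists[OF L] by blast
  obtain R' where R': "R' \<in> carrier_mat n n" "R * R' = 1\<^sub>m n" using inverse_mat_exists[OF R] by blast
  have LA: "L * A \<in> carrier_mat n n" "L * A * R \<in> carrier_mat n n" using A L R by auto
  have "kernel.dim n (L * A * R) = kernel.dim n (L * A)"
    by (rule mat_kernel_dim_mult_eq_right[OF LA(1) R(1) R'])
  also have "\<dots> = kernel.dim n A"
    by (simp only: mat_kernel_mult_eq[OF A L(1) L'])
  finally have "kernel.dim n (L * A * R) = kernel.dim n A" .
  thus ?thesis using rank_plus_kernel_dim[OF A] rank_plus_kernel_dim[OF LA(2)] by simp
qed

lemma det_zero_of_rank:
  assumes "(A :: 'a::field mat) \<in> carrier_mat (Suc n) (Suc n)" "vec_space.rank (Suc n) A = n"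
  shows "det A = 0"
  using vec_space.det_rank_iff[OF assms(1)] assms(2) by auto

text \<open>Bases whose last vectors span the left and the right kernel of \<open>A\<close> make the last row and column
vanish; the remaining block is invertible, since the kernel is no larger than a line.\<close>

lemma corank_one_normal_form:
  assumes A: "(A :: 'a::field mat) \<in> carrier_mat (Suc n) (Suc n)" and r: "vec_space.rank (Suc n) A = n"
  obtains L R where "L \<in> carrier_mat (Suc n) (Suc n)" "det L \<noteq> 0"
    "R \<in> carrier_mat (Suc n) (Suc n)" "det R \<noteq> 0"
    "L * A * R = four_block_mat (1\<^sub>m n) (0\<^sub>m n 1) (0\<^sub>m 1 n) (0\<^sub>m 1 1)"
proof -
  let ?N = "Suc n"
  have d: "det A = 0" by (rule det_zero_of_rank[OF A r])
  then obtain y where y: "y \<in> carrier_vec ?N" "y \<noteq> 0\<^sub>v ?N" "A *\<^sub>v y = 0\<^sub>v ?N"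
    using det_0_iff_vec_prod_zero[OF A] by blast
  have At: "transpose_mat A \<in> carrier_mat ?N ?N" "det (transpose_mat A) = 0"
    using A d det_transpose[OF A] by auto
  then obtain x where x: "x \<in> carrier_vec ?N" "x \<noteq> 0\<^sub>v ?N" "transpose_mat A *\<^sub>v x = 0\<^sub>v ?N"
    using det_0_iff_vec_prod_zero[OF At(1)] by blast
  obtain R where R: "R \<in> carrier_mat ?N ?N" "det R \<noteq> 0" "col R n = y"
    using invertible_with_col[OF y(1,2), of n] by blast
  obtain K where K: "K \<in> carrier_mat ?N ?N" "det K \<noteq> 0" "col K n = x"
    using invertible_with_col[OF x(1,2), of n] by blast
  have Kt: "transpose_mat K \<in> carrier_mat ?N ?N" "det (transpose_mat K) \<noteq> 0"
    using K det_transpose[OF K(1)] by auto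
  define M where "M = transpose_mat K * A * R"
  have M: "M \<in> carrier_mat (n + 1) (n + 1)" using A K R by (simp add: M_def)
  have rM: "vec_space.rank ?N M = n" unfolding M_def using rank_mult_invertible[OF A Kt R(1,2)] r by simp
  have M_assoc: "M = transpose_mat K * (A * R)" unfolding M_def using A Kt R by simp
  have Mcol: "M $$ (i, n) = 0" if "i < ?N" for i
  proof -
    have "col (A * R) n = 0\<^sub>v ?N" using col_mult2[OF A R(1), of n] R(3) y(3) by simp
    thus ?thesis unfolding M_assoc using that A Kt R by (simp add: row_carrier_vec)
  qed
  have Mrow: "M $$ (n, j) = 0" if j: "j < ?N" for j
  proof -
    have "M $$ (n, j) = x \<bullet> col (A * R) j" unfolding M_assoc using j A K R by simp
    also have "col (A * R) j = A *\<^sub>v col R j" using col_mult2[OF A R(1) j] .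
    also have "x \<bullet> (A *\<^sub>v col R j) = (transpose_mat A *\<^sub>v x) \<bullet> col R j"
      using j A R x by (intro transpose_vec_mult_scalar[symmetric]) auto
    finally show ?thesis using x(3) j R by simp
  qed
  obtain G U V Z where bl: "G \<in> carrier_mat n n" "U \<in> carrier_mat n 1" "V \<in> carrier_mat 1 n"
      "Z \<in> carrier_mat 1 1" "M = four_block_mat G U V Z"
    using four_block_cases[OF M] by blast
  have "U $$ (i, 0) = 0" "V $$ (0, i) = 0" if "i < n" for i
    using Mcol[of i] Mrow[of i] that bl(1-4) unfolding bl(5) by auto
  moreover have "Z $$ (0, 0) = 0" using Mcol[of n] bl(1-4) unfolding bl(5) by auto
  ultimately have "U = 0\<^sub>m n 1" "V = 0\<^sub>m 1 n" "Z = 0\<^sub>m 1 1"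
    using bl(2-4) by (auto intro!: eq_matI)
  hence MG: "M = four_block_mat G (0\<^sub>m n 1) (0\<^sub>m 1 n) (0\<^sub>m 1 1)" using bl(5) by simp
  have "det G \<noteq> 0"
  proof
    assume "det G = 0"
    then obtain g where g: "g \<in> carrier_vec n" "g \<noteq> 0\<^sub>v n" "G *\<^sub>v g = 0\<^sub>v n"
      using det_0_iff_vec_prod_zero[OF bl(1)] by blast
    have M': "M \<in> carrier_mat ?N ?N" using M by simp
    have "M *\<^sub>v (g @\<^sub>v 0\<^sub>v 1) = (G *\<^sub>v g + 0\<^sub>m n 1 *\<^sub>v 0\<^sub>v 1) @\<^sub>v (0\<^sub>m 1 n *\<^sub>v g + 0\<^sub>m 1 1 *\<^sub>v 0\<^sub>v 1)"
      unfolding MG using bl(1) g(1) by (intro four_block_mat_mult_vec) auto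
    also have "\<dots> = 0\<^sub>v ?N" using g by (intro eq_vecI) auto
    finally have 1: "M *\<^sub>v (g @\<^sub>v 0\<^sub>v 1) = 0\<^sub>v ?N" .
    have 2: "M *\<^sub>v unit_vec ?N n = 0\<^sub>v ?N" using M' Mcol by (intro eq_vecI) auto
    have gc: "g @\<^sub>v 0\<^sub>v 1 \<in> carrier_vec ?N" using g(1) by (metis Suc_eq_plus1 append_carrier_vec zero_carrier_vec)
    obtain c where c: "g @\<^sub>v 0\<^sub>v 1 = c \<cdot>\<^sub>v unit_vec ?N n"
      using kernel_vectors_proportional[OF M' rM _ 2 _ gc 1] by auto
    have "g $ i = 0" if "i < n" for i
      using arg_cong[OF c, of "\<lambda>v. v $ i"] that g(1) by simp
    hence "g = 0\<^sub>v n" using g(1) by (intro eq_vecI) auto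
    with g(2) show False ..
  qed
  then obtain H where H: "H \<in> carrier_mat n n" "H * G = 1\<^sub>m n" "det H \<noteq> 0"
    using inverse_mat_exists[OF bl(1)] by blast
  let ?H = "four_block_mat H (0\<^sub>m n 1) (0\<^sub>m 1 n) (1\<^sub>m 1)"
  have Hc: "?H \<in> carrier_mat ?N ?N" using H(1) four_block_carrier_mat[of H n n "1\<^sub>m 1" 1 1] by simp
  have "det ?H \<noteq> 0" using H by (subst det_four_block_mat_lower_left_zero) auto
  hence "det (?H * transpose_mat K) \<noteq> 0" using Kt det_mult[OF Hc Kt(1)] by simp
  moreover have "?H * transpose_mat K * A * R = four_block_mat (1\<^sub>m n) (0\<^sub>m n 1) (0\<^sub>m 1 n) (0\<^sub>m 1 1)"
  proof -
    have "?H * transpose_mat K * A * R = ?H * M"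
      unfolding M_def using Hc Kt(1) A R(1) by (simp add: assoc_mult_mat[of _ ?N ?N _ ?N _ ?N])
    also have "\<dots> = four_block_mat (1\<^sub>m n) (0\<^sub>m n 1) (0\<^sub>m 1 n) (0\<^sub>m 1 1)"
      unfolding MG using H bl(1) by (subst mult_four_block_mat[of _ n n _ 1 _ 1 _ _ n _ 1]) auto
    finally show ?thesis .
  qed
  ultimately show ?thesis using that[OF mult_carrier_mat[OF Hc Kt(1)] _ R(1,2)] by blast
qed

lemma corank_one_equivalent:
  assumes A: "(A :: 'a::field mat) \<in> carrier_mat (Suc n) (Suc n)" "vec_space.rank (Suc n) A = n"
    and B: "B \<in> carrier_mat (Suc n) (Suc n)" "vec_space.rank (Suc n) B = n"
  obtains L R where "L \<in> carrier_mat (Suc n) (Suc n)" "det L \<noteq> 0"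
    "R \<in> carrier_mat (Suc n) (Suc n)" "det R \<noteq> 0" "A = L * B * R"
proof -
  let ?N = "Suc n"
  obtain L R where LR: "L \<in> carrier_mat ?N ?N" "det L \<noteq> 0" "R \<in> carrier_mat ?N ?N" "det R \<noteq> 0"
    "L * A * R = four_block_mat (1\<^sub>m n) (0\<^sub>m n 1) (0\<^sub>m 1 n) (0\<^sub>m 1 1)"
    using corank_one_normal_form[OF A] by blast
  obtain P Q where PQ: "P \<in> carrier_mat ?N ?N" "det P \<noteq> 0" "Q \<in> carrier_mat ?N ?N" "det Q \<noteq> 0"
    "P * B * Q = four_block_mat (1\<^sub>m n) (0\<^sub>m n 1) (0\<^sub>m 1 n) (0\<^sub>m 1 1)"
    using corank_one_normal_form[OF B] by blast
  obtain L' where L': "L' \<in> carrier_mat ?N ?N" "L' * L = 1\<^sub>m ?N" "det L' \<noteq> 0"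
    using inverse_mat_exists[OF LR(1,2)] by blast
  obtain R' where R': "R' \<in> carrier_mat ?N ?N" "R * R' = 1\<^sub>m ?N" "det R' \<noteq> 0"
    using inverse_mat_exists[OF LR(3,4)] by blast
  note as = assoc_mult_mat[of _ ?N ?N _ ?N _ ?N]
  have "A = (L' * L) * (A * (R * R'))" using A(1) by (simp add: L' R')
  also have "\<dots> = L' * (L * A * R) * R'" using A(1) LR(1,3) L'(1) R'(1) by (simp add: as)
  also have "\<dots> = (L' * P) * B * (Q * R')"
    unfolding LR(5) PQ(5)[symmetric] using B(1) PQ(1,3) L'(1) R'(1) by (simp add: as)
  finally have "A = (L' * P) * B * (Q * R')" .
  moreover have "det (L' * P) \<noteq> 0" "det (Q * R') \<noteq> 0"
    using L' R' PQ det_mult[OF L'(1) PQ(1)] det_mult[OF PQ(3) R'(1)] by auto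
  ultimately show ?thesis
    using that mult_carrier_mat[OF L'(1) PQ(1)] mult_carrier_mat[OF PQ(3) R'(1)] by blast
qed

section \<open>Corank one forms with paired radicals\<close>

text \<open>In a basis that ends with \<open>y\<close>, the vector \<open>x\<close> has a nonzero part in front of its last
coordinate; complete that part to an invertible block.\<close>

lemma invertible_with_two_cols:
  assumes y: "(y :: 'a::field vec) \<in> carrier_vec (m + 2)" "y \<noteq> 0\<^sub>v (m + 2)"
    and x: "x \<in> carrier_vec (m + 2)" "\<And>c. x \<noteq> c \<cdot>\<^sub>v y"
  obtains T where "T \<in> carrier_mat (m + 2) (m + 2)" "det T \<noteq> 0" "col T m = x" "col T (m + 1) = y"
proof -
  let ?N = "m + 2"
  obtain P where P: "P \<in> carrier_mat ?N ?N" "det P \<noteq> 0" "col P (m + 1) = y"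
    using invertible_with_col[OF y, of "m + 1"] by auto
  obtain S where S: "S \<in> carrier_mat ?N ?N" "P * S = 1\<^sub>m ?N"
    using inverse_mat_exists[OF P(1,2)] by blast
  define x' where "x' = S *\<^sub>v x"
  have x': "x' \<in> carrier_vec ?N" using S x by (simp add: x'_def)
  have "P *\<^sub>v x' = P * S *\<^sub>v x"
    unfolding x'_def using P(1) S(1) x(1) by (rule assoc_mult_mat_vec[symmetric])
  hence Px: "P *\<^sub>v x' = x" using S x by simp
  have Py: "P *\<^sub>v unit_vec ?N (m + 1) = y"
    unfolding P(3)[symmetric] using P(1) by (intro eq_vecI) auto
  define u where "u = vec (m + 1) (\<lambda>i. x' $ i)"
  have "u \<noteq> 0\<^sub>v (m + 1)"
  proof
    assume u: "u = 0\<^sub>v (m + 1)"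
    have z: "x' $ i = 0" if "i < m + 1" for i
      using arg_cong[OF u, of "\<lambda>v. v $ i"] that by (simp add: u_def)
    have e: "x' = x' $ (m + 1) \<cdot>\<^sub>v unit_vec ?N (m + 1)"
    proof (rule eq_vecI)
      fix i assume "i < dim_vec (x' $ (m + 1) \<cdot>\<^sub>v unit_vec ?N (m + 1))"
      hence "i < m + 1 \<or> i = m + 1" by auto
      thus "x' $ i = (x' $ (m + 1) \<cdot>\<^sub>v unit_vec ?N (m + 1)) $ i" using z by auto
    qed (use x' in simp)
    have "x = P *\<^sub>v (x' $ (m + 1) \<cdot>\<^sub>v unit_vec ?N (m + 1))"
      unfolding Px[symmetric] by (rule arg_cong[OF e])
    also have "\<dots> = x' $ (m + 1) \<cdot>\<^sub>v y"
      unfolding mult_mat_vec[OF P(1) unit_vec_carrier] Py ..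
    finally show False using x(2) by blast
  qed
  moreover have "u \<in> carrier_vec (m + 1)" by (simp add: u_def)
  ultimately obtain H where H: "H \<in> carrier_mat (m + 1) (m + 1)" "det H \<noteq> 0" "col H m = u"
    using invertible_with_col[of u "m + 1" m] by auto
  define h where "h = mat 1 (m + 1) (\<lambda>(i, j). if j = m then x' $ (m + 1) else 0)"
  define K where "K = four_block_mat H (0\<^sub>m (m + 1) 1) h (1\<^sub>m 1)"
  have h: "h \<in> carrier_mat 1 (m + 1)" by (simp add: h_def)
  have K: "K \<in> carrier_mat ?N ?N"
    using four_block_carrier_mat[OF H(1) one_carrier_mat[of 1]] by (simp add: K_def)
  have "det K = det H"
    unfolding K_def using H(1) h by (subst det_four_block_mat_upper_right_zero) auto
  hence "det (P * K) \<noteq> 0" using H(2) P(2) det_mult[OF P(1) K] by simp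
  moreover have "col (P * K) m = x"
  proof -
    have "col K m = x'"
    proof (rule eq_vecI)
      fix i assume "i < dim_vec x'"
      hence i: "i < ?N" using x' by simp
      show "col K m $ i = x' $ i"
      proof (cases "i < m + 1")
        case True
        hence "H $$ (i, m) = u $ i" using arg_cong[OF H(3), of "\<lambda>v. v $ i"] H(1) by simp
        thus ?thesis using True i K H(1) by (simp add: K_def u_def)
      next
        case False
        hence "i = m + 1" using i by simp
        thus ?thesis using K H(1) by (simp add: K_def h_def)
      qed
    qed (use K x' in simp)
    thus ?thesis using col_mult2[OF P(1) K, of m] Px by simp
  qed
  moreover have "col (P * K) (m + 1) = y"
  proof -
    have "col K (m + 1) = unit_vec ?N (m + 1)"
      using K H(1) by (intro eq_vecI) (auto simp: K_def)
    thus ?thesis using col_mult2[OF P(1) K, of "m + 1"] Py by simp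
  qed
  ultimately show ?thesis using that mult_carrier_mat[OF P(1) K] by blast
qed

context frobenius
begin

lemma rank_frob_equiv:
  assumes "(A :: 'a mat) \<in> carrier_mat n n" "frob_equiv n q A B"
  shows "vec_space.rank n B = vec_space.rank n A"
proof -
  obtain T where T: "T \<in> carrier_mat n n" "det T \<noteq> 0" "B = transpose_mat T * A * frob_twist q T"
    using assms unfolding frob_equiv_iff_det by blast
  show ?thesis unfolding T(3)
    by (rule rank_mult_invertible) (use assms(1) T det_transpose[OF T(1)] in \<open>auto simp: det_frob_twist\<close>)
qed

lemma frob_equiv_subdiag:
  assumes E: "(E :: 'a mat) \<in> carrier_mat 2 2" and E0: "E $$ (0, 0) = 0" "E $$ (0, 1) = 0" "E $$ (1, 1) = 0"
    and b: "E $$ (1, 0) \<noteq> 0"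
  shows "frob_equiv 2 q E (subdiag_mat 2)"
  unfolding frob_equiv_iff_det
proof (intro bexI conjI)
  let ?c = "inverse (E $$ (1, 0))"
  let ?T = "four_block_mat (1\<^sub>m 1) (0\<^sub>m 1 1) (0\<^sub>m 1 1) (?c \<cdot>\<^sub>m 1\<^sub>m 1)"
  show T: "?T \<in> carrier_mat 2 2"
    using four_block_carrier_mat[of "1\<^sub>m 1" 1 1 "?c \<cdot>\<^sub>m 1\<^sub>m 1" 1 1] by (simp add: numeral_2_eq_2)
  show "det ?T \<noteq> 0" using b by (subst det_four_block_mat_lower_left_zero) auto
  show "subdiag_mat 2 = transpose_mat ?T * E * frob_twist q ?T" (is "_ = ?M")
  proof (rule eq_matI)
    fix i j assume "i < dim_row ?M" "j < dim_col ?M"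
    hence ij: "i < 2" "j < 2" using T by (auto simp: frob_twist_def)
    have l: "{0..<2} = {0, 1 :: nat}" by auto
    have E0': "E $$ (0, Suc 0) = 0" "E $$ (Suc 0, Suc 0) = 0" "E $$ (Suc 0, 0) \<noteq> 0" using E0 b by auto
    show "subdiag_mat 2 $$ (i, j) = ?M $$ (i, j)"
      using ij E E0 E0' q_gt_1
      by (auto simp: less_2_cases_iff subdiag_mat_def scalar_prod_def l frob_twist_def)
  qed (use T E in \<open>auto simp: subdiag_mat_def frob_twist_def\<close>)
qed

text \<open>The hypotheses put \<open>x\<close> into the left and \<open>y\<close> into the right radical of the form and make the
two radicals pair nontrivially. In a basis ending with \<open>x, y\<close> the Gram matrix has a zero
row, a zero column and one nonzero entry \<open>b\<close> in the lower right block; \<open>b\<close> clears its column by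
a linear equation and its row after extraction of a \<open>q\<close>-th root.\<close>

theorem corank_one_frob_equiv:
  assumes A: "(A :: 'a mat) \<in> carrier_mat (m + 2) (m + 2)" "vec_space.rank (m + 2) A = m + 1"
    and y: "y \<in> carrier_vec (m + 2)" "A *\<^sub>v map_vec (\<lambda>x. x ^ q) y = 0\<^sub>v (m + 2)"
    and x: "x \<in> carrier_vec (m + 2)" "transpose_mat A *\<^sub>v x = 0\<^sub>v (m + 2)"
    and xy: "frob_form A y x \<noteq> 0"
  shows "frob_equiv (m + 2) q A (four_block_mat (1\<^sub>m m) (0\<^sub>m m 2) (0\<^sub>m 2 m) (subdiag_mat 2))"
proof -
  let ?N = "m + 2"
  let ?F = "map_vec (\<lambda>x :: 'a. x ^ q)"
  have right: "frob_form A w y = 0" if "w \<in> carrier_vec ?N" for w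
    unfolding frob_form_def y(2) using that by simp
  have left: "frob_form A x w = 0" if "w \<in> carrier_vec ?N" for w
  proof -
    have "frob_form A x w = (transpose_mat A *\<^sub>v x) \<bullet> ?F w"
      unfolding frob_form_def using A(1) x(1) that by (intro transpose_vec_mult_scalar[symmetric]) auto
    thus ?thesis using x(2) that by simp
  qed
  have y0: "y \<noteq> 0\<^sub>v ?N"
  proof
    assume "y = 0\<^sub>v ?N"
    hence "frob_form A y x = 0" unfolding frob_form_def using A(1) x(1) by auto
    with xy show False ..
  qed
  have xc: "x \<noteq> c \<cdot>\<^sub>v y" for c
  proof
    assume e: "x = c \<cdot>\<^sub>v y"
    have "?F x = c ^ q \<cdot>\<^sub>v ?F y" unfolding e by (intro eq_vecI) (auto simp: power_mult_distrib)
    hence "A *\<^sub>v ?F x = c ^ q \<cdot>\<^sub>v (A *\<^sub>v ?F y)" using mult_mat_vec[OF A(1)] y(1) by simp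
    hence "frob_form A y x = 0" unfolding frob_form_def y(2) using y(1) by simp
    with xy show False ..
  qed
  obtain T where T: "T \<in> carrier_mat ?N ?N" "det T \<noteq> 0" "col T m = x" "col T (m + 1) = y"
    using invertible_with_two_cols[OF y(1) y0 x(1) xc] by blast
  define C where "C = transpose_mat T * A * frob_twist q T"
  have AC: "frob_equiv ?N q A C" unfolding frob_equiv_iff_det C_def using T by blast
  have C: "C \<in> carrier_mat ?N ?N" unfolding C_def using A(1) T(1) by simp
  have C_nth: "C $$ (i, j) = frob_form A (col T i) (col T j)" if "i < ?N" "j < ?N" for i j
    unfolding C_def using A(1) T(1) that by (rule index_frob_congruence)
  have C_row: "C $$ (m, j) = 0" if "j < ?N" for j
    using that T(1) left by (subst C_nth) (auto simp: T(3))
  have C_col: "C $$ (i, m + 1) = 0" if "i < ?N" for i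
    using that T(1) right[of "col T i"] C_nth[of i "m + 1", unfolded T(4)] by auto
  have C_b: "C $$ (m + 1, m) \<noteq> 0" using C_nth[of "m + 1" m, unfolded T(3,4)] xy by simp
  obtain D U V E where bl: "D \<in> carrier_mat m m" "U \<in> carrier_mat m 2" "V \<in> carrier_mat 2 m"
      "E \<in> carrier_mat 2 2" "C = four_block_mat D U V E"
    using four_block_cases[OF C] by blast
  have U1: "U $$ (i, 1) = 0" if "i < m" for i using C_col[of i] that bl(1-4) unfolding bl(5) by auto
  have V0: "V $$ (0, j) = 0" if "j < m" for j using C_row[of j] that bl(1-4) unfolding bl(5) by auto
  have E0: "E $$ (0, 0) = 0" "E $$ (0, 1) = 0" "E $$ (1, 1) = 0" "E $$ (1, 0) \<noteq> 0"
    using C_row[of m] C_row[of "m + 1"] C_col[of "m + 1"] C_b bl(1-4) unfolding bl(5) by auto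
  define b where "b = E $$ (1, 0)"
  have b0: "b \<noteq> 0" using E0 by (simp add: b_def)
  \<comment> \<open>In the solution \<open>X\<close> the row of \<open>y\<close> is determined by \<open>U\<close> and the row of \<open>x\<close>, up to \<open>q\<close>-th roots, by \<open>V\<close>.\<close>
  have "\<exists>z. z ^ q = - V $$ (1, j) / b" for j using nth_root_exists[of q] q_gt_1 by simp
  then obtain f where f: "f j ^ q = - V $$ (1, j) / b" for j by metis
  define X where "X = mat 2 m (\<lambda>(i, j). if i = 0 then f j else - U $$ (j, 0) / b)"
  have X: "X \<in> carrier_mat 2 m" by (simp add: X_def)
  have l: "{0..<2} = {0, 1 :: nat}" by auto
  have XU: "U + transpose_mat X * E = 0\<^sub>m m 2"
  proof (rule eq_matI)
    fix i j assume "i < dim_row (0\<^sub>m m 2 :: 'a mat)" "j < dim_col (0\<^sub>m m 2 :: 'a mat)"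
    thus "(U + transpose_mat X * E) $$ (i, j) = 0\<^sub>m m 2 $$ (i, j)"
      using bl(2,4) X U1 E0 b0
      by (auto simp: less_2_cases_iff scalar_prod_def l X_def b_def)
  qed (use bl X in auto)
  have XV: "V + E * frob_twist q X = 0\<^sub>m 2 m"
  proof (rule eq_matI)
    fix i j assume "i < dim_row (0\<^sub>m 2 m :: 'a mat)" "j < dim_col (0\<^sub>m 2 m :: 'a mat)"
    thus "(V + E * frob_twist q X) $$ (i, j) = 0\<^sub>m 2 m $$ (i, j)"
      using bl(3,4) X V0 E0 b0 f[of j]
      by (auto simp: less_2_cases_iff scalar_prod_def l X_def b_def frob_twist_def)
  qed (use bl X in \<open>auto simp: frob_twist_def\<close>)
  define D' where "D' = D + transpose_mat X * V"
  define G where "G = four_block_mat D' (0\<^sub>m m 2) (0\<^sub>m 2 m) E"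
  have D': "D' \<in> carrier_mat m m" using bl X by (simp add: D'_def)
  have CG: "frob_equiv ?N q C G"
    using frob_equiv_block_diagonal[OF bl(1-4) X XU XV] unfolding bl(5) G_def D'_def .
  have G: "G \<in> carrier_mat (Suc (m + 1)) (Suc (m + 1))"
    unfolding G_def using four_block_carrier_mat[OF D' bl(4)] by simp
  have rG: "vec_space.rank (Suc (m + 1)) G = m + 1"
    using rank_frob_equiv[OF C CG] rank_frob_equiv[OF A(1) AC] A(2) by simp
  have "det D' \<noteq> 0"
  proof
    assume "det D' = 0"
    then obtain d where d: "d \<in> carrier_vec m" "d \<noteq> 0\<^sub>v m" "D' *\<^sub>v d = 0\<^sub>v m"
      using det_0_iff_vec_prod_zero[OF D'] by blast
    \<comment> \<open>A kernel vector of \<open>D'\<close> and the last basis vector would be independent elements of the kernel.\<close>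
    have GG: "G *\<^sub>v (v @\<^sub>v w) = (D' *\<^sub>v v) @\<^sub>v (E *\<^sub>v w)"
      if "v \<in> carrier_vec m" "w \<in> carrier_vec 2" for v w
    proof -
      have "G *\<^sub>v (v @\<^sub>v w) = (D' *\<^sub>v v + 0\<^sub>m m 2 *\<^sub>v w) @\<^sub>v (0\<^sub>m 2 m *\<^sub>v v + E *\<^sub>v w)"
        unfolding G_def using D' bl(4) that by (intro four_block_mat_mult_vec) auto
      also have "0\<^sub>m m 2 *\<^sub>v w = 0\<^sub>v m" using that by (intro eq_vecI) auto
      also have "0\<^sub>m 2 m *\<^sub>v v = 0\<^sub>v 2" using that by (intro eq_vecI) auto
      also have "D' *\<^sub>v v + 0\<^sub>v m = D' *\<^sub>v v" using that D' by (intro right_zero_vec) auto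
      also have "0\<^sub>v 2 + E *\<^sub>v w = E *\<^sub>v w" using that bl(4) by (intro left_zero_vec) auto
      finally show ?thesis .
    qed
    have E1: "E *\<^sub>v unit_vec 2 1 = 0\<^sub>v 2"
      using bl(4) E0 by (intro eq_vecI) (auto simp: less_2_cases_iff)
    have E00: "E *\<^sub>v 0\<^sub>v 2 = 0\<^sub>v 2" using bl(4) by (intro eq_vecI) auto
    have D0: "D' *\<^sub>v 0\<^sub>v m = 0\<^sub>v m" using D' by (intro eq_vecI) auto
    have z: "0\<^sub>v m @\<^sub>v 0\<^sub>v 2 = (0\<^sub>v (Suc (m + 1)) :: 'a vec)" by (intro eq_vecI) auto
    let ?v = "0\<^sub>v m @\<^sub>v unit_vec 2 1 :: 'a vec" and ?w = "d @\<^sub>v 0\<^sub>v 2"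
    have Gv: "G *\<^sub>v ?v = 0\<^sub>v (Suc (m + 1))"
      unfolding GG[OF zero_carrier_vec unit_vec_carrier] D0 E1 z ..
    have Gw: "G *\<^sub>v ?w = 0\<^sub>v (Suc (m + 1))"
      unfolding GG[OF d(1) zero_carrier_vec] d(3) E00 z ..
    have vc: "?v \<in> carrier_vec (Suc (m + 1))" "?w \<in> carrier_vec (Suc (m + 1))"
      using carrier_vecD[OF d(1)] by (auto intro!: carrier_vecI)
    have "?v \<noteq> 0\<^sub>v (Suc (m + 1))"
    proof
      assume "?v = 0\<^sub>v (Suc (m + 1))"
      from arg_cong[OF this, of "\<lambda>v. v $ (m + 1)"] show False by simp
    qed
    from kernel_vectors_proportional[OF G rG vc(1) Gv this vc(2) Gw]
    obtain c where c: "?w = c \<cdot>\<^sub>v ?v" by blast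
    have "d $ i = 0" if "i < m" for i
      using arg_cong[OF c, of "\<lambda>v. v $ i"] that d(1) by simp
    hence "d = 0\<^sub>v m" using d(1) by (intro eq_vecI) auto
    with d(2) show False ..
  qed
  from frob_equiv_block[OF D' bl(4) nondegenerate_frob_equiv_one[OF D' this] frob_equiv_subdiag[OF bl(4) E0]]
  have "frob_equiv ?N q G (four_block_mat (1\<^sub>m m) (0\<^sub>m m 2) (0\<^sub>m 2 m) (subdiag_mat 2))"
    unfolding G_def .
  from frob_equiv_trans[OF A(1) AC frob_equiv_trans[OF C CG this]] show ?thesis .
qed

end

section \<open>Regular functions and irreducibility of the rank locus\<close>

text \<open>A member of \<open>poly_funs N\<close> is a function on matrices of all sizes, whereas the determinant is
polynomial only on matrices of a fixed size; so functions are compared on \<open>carrier_mat N N\<close>.\<close>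

definition regular_on :: "nat \<Rightarrow> ('a::field mat \<Rightarrow> 'a) \<Rightarrow> bool" where
  "regular_on N f \<longleftrightarrow> (\<exists>g \<in> poly_funs N. \<forall>A \<in> carrier_mat N N. f A = g A)"

lemma regular_on_cong:
  "regular_on N g \<Longrightarrow> (\<And>A. A \<in> carrier_mat N N \<Longrightarrow> f A = g A) \<Longrightarrow> regular_on N f"
  unfolding regular_on_def by auto

lemma regular_on_poly_funs: "f \<in> poly_funs N \<Longrightarrow> regular_on N f"
  unfolding regular_on_def by blast

lemma regular_on_const: "regular_on N (\<lambda>A. c)"
  by (intro regular_on_poly_funs poly_funs.const)

lemma regular_on_entry: "i < N \<Longrightarrow> j < N \<Longrightarrow> regular_on N (\<lambda>A. A $$ (i, j))"
  by (intro regular_on_poly_funs poly_funs.entry)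

lemma regular_on_add:
  assumes "regular_on N f" "regular_on N g"
  shows "regular_on N (\<lambda>A. f A + g A)"
proof -
  obtain f' g' where "f' \<in> poly_funs N" "\<forall>A \<in> carrier_mat N N. f A = f' A"
    "g' \<in> poly_funs N" "\<forall>A \<in> carrier_mat N N. g A = g' A"
    using assms unfolding regular_on_def by blast
  thus ?thesis unfolding regular_on_def by (intro bexI[OF _ poly_funs.add[of f' N g']]) auto
qed

lemma regular_on_mult:
  assumes "regular_on N f" "regular_on N g"
  shows "regular_on N (\<lambda>A. f A * g A)"
proof -
  obtain f' g' where "f' \<in> poly_funs N" "\<forall>A \<in> carrier_mat N N. f A = f' A"
    "g' \<in> poly_funs N" "\<forall>A \<in> carrier_mat N N. g A = g' A"
    using assms unfolding regular_on_def by blast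
  thus ?thesis unfolding regular_on_def by (intro bexI[OF _ poly_funs.mult[of f' N g']]) auto
qed

lemma regular_on_power: "regular_on N f \<Longrightarrow> regular_on N (\<lambda>A. f A ^ k)"
  by (induction k) (auto intro: regular_on_const regular_on_mult)

lemma regular_on_sum: "(\<And>x. x \<in> I \<Longrightarrow> regular_on N (f x)) \<Longrightarrow> regular_on N (\<lambda>A. \<Sum>x\<in>I. f x A)"
  by (induction I rule: infinite_finite_induct) (auto intro: regular_on_const regular_on_add)

lemma regular_on_prod: "(\<And>x. x \<in> I \<Longrightarrow> regular_on N (f x)) \<Longrightarrow> regular_on N (\<lambda>A. \<Prod>x\<in>I. f x A)"
  by (induction I rule: infinite_finite_induct) (auto intro: regular_on_const regular_on_mult)

lemma regular_on_det:
  assumes "\<And>A. A \<in> carrier_mat N N \<Longrightarrow> M A \<in> carrier_mat k k"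
    and "\<And>i j. i < k \<Longrightarrow> j < k \<Longrightarrow> regular_on N (\<lambda>A. M A $$ (i, j))"
  shows "regular_on N (\<lambda>A. det (M A))"
proof (rule regular_on_cong)
  show "regular_on N (\<lambda>A. \<Sum>p | p permutes {0..<k}. signof p * (\<Prod>i = 0..<k. M A $$ (i, p i)))"
    by (intro regular_on_sum regular_on_mult regular_on_const regular_on_prod assms(2))
      (auto dest: permutes_in_image)
qed (use assms(1) in \<open>auto simp: det_def'\<close>)

lemma regular_on_cofactor:
  assumes "i < N" "j < N"
  shows "regular_on N (\<lambda>A. cofactor A i j)"
  unfolding cofactor_def
proof (intro regular_on_mult regular_on_const regular_on_det[where k = "N - 1"])
  fix k l assume kl: "k < N - 1" "l < N - 1"
  show "regular_on N (\<lambda>A. mat_delete A i j $$ (k, l))"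
    by (rule regular_on_cong[OF regular_on_entry[of "if k < i then k else Suc k" N "if l < j then l else Suc l"]])
      (use kl in \<open>auto simp: mat_delete_def\<close>)
qed (rule mat_delete_carrier)

definition poly_path :: "nat \<Rightarrow> ('a::field \<Rightarrow> 'a mat) \<Rightarrow> bool" where
  "poly_path N A \<longleftrightarrow> (\<forall>t. A t \<in> carrier_mat N N) \<and>
     (\<forall>i<N. \<forall>j<N. \<exists>P. \<forall>t. A t $$ (i, j) = poly P t)"

lemma regular_on_poly_path:
  assumes "regular_on N f" and A: "poly_path N A"
  obtains P where "\<And>t. f (A t) = poly P t"
proof -
  obtain g where g: "g \<in> poly_funs N" "\<forall>A \<in> carrier_mat N N. f A = g A"
    using assms unfolding regular_on_def by blast
  from g(1) have "\<exists>P. \<forall>t. g (A t) = poly P t"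
  proof induction
    case (const c)
    show ?case by (rule exI[of _ "[:c:]"]) simp
  next
    case (entry i j)
    thus ?case using A unfolding poly_path_def by blast
  next
    case (add f g)
    then obtain P Q where "\<forall>t. f (A t) = poly P t" "\<forall>t. g (A t) = poly Q t" by blast
    thus ?case by (intro exI[of _ "P + Q"]) simp
  next
    case (mult f g)
    then obtain P Q where "\<forall>t. f (A t) = poly P t" "\<forall>t. g (A t) = poly Q t" by blast
    thus ?case by (intro exI[of _ "P * Q"]) simp
  qed
  then obtain P where "\<And>t. g (A t) = poly P t" by blast
  moreover have "f (A t) = g (A t)" for t using g(2) A unfolding poly_path_def by blast
  ultimately show ?thesis using that by simp
qed

lemma poly_path_const: "A \<in> carrier_mat N N \<Longrightarrow> poly_path N (\<lambda>t. A)"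
proof -
  assume "A \<in> carrier_mat N N"
  moreover have "\<exists>P. \<forall>t. A $$ (i, j) = poly P t" for i j
    by (rule exI[of _ "[:A $$ (i, j):]"]) simp
  ultimately show ?thesis unfolding poly_path_def by blast
qed

lemma poly_path_mult:
  assumes A: "poly_path N A" and B: "poly_path N B"
  shows "poly_path N (\<lambda>t. A t * B t)"
proof -
  have c: "A t \<in> carrier_mat N N" "B t \<in> carrier_mat N N" for t using A B by (auto simp: poly_path_def)
  obtain P where P: "\<And>i j t. i < N \<Longrightarrow> j < N \<Longrightarrow> A t $$ (i, j) = poly (P i j) t"
    using A unfolding poly_path_def by metis
  obtain Q where Q: "\<And>i j t. i < N \<Longrightarrow> j < N \<Longrightarrow> B t $$ (i, j) = poly (Q i j) t"
    using B unfolding poly_path_def by metis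
  have "(A t * B t) $$ (i, j) = poly (\<Sum>k = 0..<N. P i k * Q k j) t" if "i < N" "j < N" for i j t
  proof -
    have "(A t * B t) $$ (i, j) = (\<Sum>k = 0..<N. A t $$ (i, k) * B t $$ (k, j))"
      using that c[of t] by (auto simp: scalar_prod_def intro!: sum.cong)
    thus ?thesis using that by (simp add: P Q poly_sum)
  qed
  thus ?thesis unfolding poly_path_def using c mult_carrier_mat by blast
qed

lemma poly_path_from_one:
  assumes L: "L \<in> carrier_mat N N" "det L \<noteq> 0"
  obtains A P where "poly_path N A" "A 0 = 1\<^sub>m N" "A 1 = L" "\<And>t. det (A t) = poly P t" "P \<noteq> 0"
proof -
  define A where "A t = 1\<^sub>m N + t \<cdot>\<^sub>m (L - 1\<^sub>m N)" for t
  have "A t $$ (i, j) = poly [:1\<^sub>m N $$ (i, j), L $$ (i, j) - 1\<^sub>m N $$ (i, j):] t" if "i < N" "j < N" for i j t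
    using L(1) that by (simp add: A_def)
  moreover have "A t \<in> carrier_mat N N" for t using L(1) unfolding A_def by auto
  ultimately have A: "poly_path N A" unfolding poly_path_def by blast
  have "regular_on N (\<lambda>A :: 'a mat. det A)" by (rule regular_on_det[where k = N]) (auto intro: regular_on_entry)
  then obtain P where P: "\<And>t. det (A t) = poly P t" using regular_on_poly_path[OF _ A] by blast
  have A0: "A 0 = 1\<^sub>m N" and A1: "A 1 = L" unfolding A_def using L(1) by (auto intro!: eq_matI)
  have "P \<noteq> 0" using P[of 1] L(2) A1 by auto
  thus ?thesis using that A A0 A1 P by blast
qed

text \<open>The equation \<open>p(t) = 1\<close> has a solution if \<open>p\<close> is not constant.\<close>

lemma nonroot_exists:
  assumes "(p :: 'a::alg_closed_field poly) \<noteq> 0"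
  shows "\<exists>t. poly p t \<noteq> 0"
proof (cases "degree p = 0")
  case True
  then obtain c where "p = [:c:]" by (rule degree_eq_zeroE)
  thus ?thesis using assms by simp
next
  case False
  hence "degree (p + [:-1:]) > 0" by (simp add: degree_add_eq_left)
  then obtain t where "poly (p + [:-1:]) t = 0" using alg_closed_imp_poly_has_root by blast
  hence "poly p t = 1" by simp
  thus ?thesis by (intro exI[of _ t]) simp
qed

text \<open>Along the curve \<open>L(t) B R(t)\<close> from \<open>B\<close> to
\<open>A = L B R\<close>, the functions \<open>f\<close> and \<open>g\<close> and the determinants of \<open>L(t)\<close> and \<open>R(t)\<close> are four
nonzero polynomials in \<open>t\<close>, so they have a common non-root. Thus basic open sets that are nonempty
on the rank locus meet on it.\<close>

theorem rank_locus_irreducible: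
  fixes f g :: "'a::alg_closed_field mat \<Rightarrow> 'a"
  assumes f: "regular_on (n + 1) f" and g: "regular_on (n + 1) g"
    and A: "A \<in> rank_locus (n + 1) n" "f A \<noteq> 0" and B: "B \<in> rank_locus (n + 1) n" "g B \<noteq> 0"
  obtains C where "C \<in> rank_locus (n + 1) n" "f C \<noteq> 0" "g C \<noteq> 0"
proof -
  let ?N = "n + 1"
  have A': "A \<in> carrier_mat ?N ?N" "vec_space.rank ?N A = n"
    and B': "B \<in> carrier_mat ?N ?N" "vec_space.rank ?N B = n"
    using A B by (auto simp: rank_locus_def)
  obtain L R where LR: "L \<in> carrier_mat ?N ?N" "det L \<noteq> 0" "R \<in> carrier_mat ?N ?N" "det R \<noteq> 0"
      "A = L * B * R"
    using corank_one_equivalent[of A n B] A' B' by auto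
  obtain F Pl where l: "poly_path ?N F" "F 0 = 1\<^sub>m ?N" "F 1 = L" "\<And>t. det (F t) = poly Pl t" "Pl \<noteq> 0"
    using poly_path_from_one[OF LR(1,2)] by blast
  obtain G Pr where r: "poly_path ?N G" "G 0 = 1\<^sub>m ?N" "G 1 = R" "\<And>t. det (G t) = poly Pr t" "Pr \<noteq> 0"
    using poly_path_from_one[OF LR(3,4)] by blast
  define C where "C t = F t * B * G t" for t
  have C: "poly_path ?N C"
    unfolding C_def by (intro poly_path_mult l(1) r(1) poly_path_const B'(1))
  have C0: "C 0 = B" and C1: "C 1 = A" using B'(1) by (simp_all add: C_def l r LR(5))
  obtain Pf where Pf: "\<And>t. f (C t) = poly Pf t" using regular_on_poly_path[OF f C] by blast
  obtain Pg where Pg: "\<And>t. g (C t) = poly Pg t" using regular_on_poly_path[OF g C] by blast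
  have "Pf \<noteq> 0" "Pg \<noteq> 0" using Pf[of 1] Pg[of 0] A(2) B(2) C0 C1 by auto
  hence "Pf * Pg * (Pl * Pr) \<noteq> 0" using l(5) r(5) by simp
  then obtain t where "poly (Pf * Pg * (Pl * Pr)) t \<noteq> 0" using nonroot_exists by blast
  hence t: "f (C t) \<noteq> 0" "g (C t) \<noteq> 0" "det (F t) \<noteq> 0" "det (G t) \<noteq> 0"
    using Pf Pg l(4) r(4) by simp_all
  have c: "F t \<in> carrier_mat ?N ?N" "G t \<in> carrier_mat ?N ?N" "C t \<in> carrier_mat ?N ?N"
    using l(1) r(1) C unfolding poly_path_def by auto
  have "vec_space.rank ?N (C t) = n"
    unfolding C_def using rank_mult_invertible[OF B'(1) c(1) t(3) c(2) t(4)] B'(2) by simp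
  hence "C t \<in> rank_locus ?N n" using c(3) by (simp add: rank_locus_def)
  thus ?thesis using that t(1,2) by blast
qed

section \<open>The pairing of the radicals as a regular function\<close>

text \<open>With \<open>c\<close> the column \<open>i\<close> and \<open>r\<close> the row \<open>j\<close> of the adjugate of \<open>A\<close>, this is
\<open>c\<^sup>T A\<^sup>(\<^sup>q\<^sup>) r\<^sup>(\<^sup>q\<^sup>2\<^sup>)\<close>, the \<open>q\<close>-th power of the value \<open>\<beta>(y, x)\<close> for \<open>y\<^sup>(\<^sup>q\<^sup>) = c\<close> and
\<open>x = r\<^sup>T\<close>. Taking the power avoids the \<open>q\<close>-th root in \<open>y\<close>, which is not polynomial in \<open>A\<close>.\<close>

definition radical_pairing :: "nat \<Rightarrow> nat \<Rightarrow> nat \<Rightarrow> nat \<Rightarrow> 'a::field mat \<Rightarrow> 'a" where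
  "radical_pairing N q i j A =
     (\<Sum>l<N. \<Sum>h<N. cofactor A i l * (A $$ (l, h) ^ q * cofactor A h j ^ (q * q)))"

lemma regular_on_radical_pairing:
  assumes "i < N" "j < N"
  shows "regular_on N (radical_pairing N q i j)"
  unfolding radical_pairing_def
  by (intro regular_on_sum regular_on_mult regular_on_power regular_on_entry regular_on_cofactor)
    (use assms in auto)

lemma (in frobenius) frob_form_eq_sum:
  assumes "A \<in> carrier_mat n n" "v \<in> carrier_vec n" "w \<in> carrier_vec n"
  shows "frob_form A v w = (\<Sum>l<n. \<Sum>h<n. v $ l * (A $$ (l, h) * w $ h ^ q))"
  unfolding frob_form_def using assms
  by (auto simp: scalar_prod_def lessThan_atLeast0 sum_distrib_left intro!: sum.cong)

text \<open>As \<open>A\<close> is singular, its products with the adjugate vanish on both sides; hence columns and rows of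
the adjugate give vectors in the right and in the left radical.\<close>

lemma (in frobenius) frob_equiv_of_radical_pairing:
  assumes A: "(A :: 'a mat) \<in> rank_locus (m + 2) (m + 1)"
    and ij: "i < m + 2" "j < m + 2" and nz: "radical_pairing (m + 2) q i j A \<noteq> 0"
  shows "frob_equiv (m + 2) q A (four_block_mat (1\<^sub>m m) (0\<^sub>m m 2) (0\<^sub>m 2 m) (subdiag_mat 2))"
proof -
  let ?N = "m + 2"
  have Ac: "A \<in> carrier_mat ?N ?N" and r: "vec_space.rank ?N A = m + 1"
    using A by (auto simp: rank_locus_def)
  have d: "det A = 0" using det_zero_of_rank[of A "m + 1"] Ac r by simp
  note adj = adj_mat[OF Ac, unfolded d]
  have adj_nth: "adj_mat A $$ (l, h) = cofactor A h l" if "l < ?N" "h < ?N" for l h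
    using that Ac by (simp add: adj_mat_def)
  have "\<exists>z. z ^ q = cofactor A i l" for l using nth_root_exists[of q] q_gt_1 by simp
  then obtain f where f: "f l ^ q = cofactor A i l" for l by metis
  define y where "y = vec ?N f"
  define x where "x = vec ?N (\<lambda>h. cofactor A h j)"
  have Fy: "map_vec (\<lambda>x. x ^ q) y = col (adj_mat A) i"
    using adj(1) ij by (intro eq_vecI) (auto simp: y_def f adj_nth)
  have Ay: "A *\<^sub>v map_vec (\<lambda>x. x ^ q) y = 0\<^sub>v ?N"
    unfolding Fy col_mult2[OF Ac adj(1) ij(1), symmetric] adj(2)
    using ij by (intro eq_vecI) auto
  have x_row: "x = row (adj_mat A) j"
    using adj(1) ij by (intro eq_vecI) (auto simp: x_def adj_nth)
  have Ax: "transpose_mat A *\<^sub>v x = 0\<^sub>v ?N"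
  proof (rule eq_vecI)
    fix k assume k: "k < dim_vec (0\<^sub>v ?N)"
    have "(transpose_mat A *\<^sub>v x) $ k = col A k \<bullet> row (adj_mat A) j"
      using k Ac by (simp add: x_row)
    also have "\<dots> = row (adj_mat A) j \<bullet> col A k"
      using k Ac adj(1) ij by (intro comm_scalar_prod[of _ ?N]) auto
    also have "\<dots> = (adj_mat A * A) $$ (j, k)" using k ij Ac adj(1) by simp
    also have "\<dots> = 0" unfolding adj(3) using k ij by simp
    finally show "(transpose_mat A *\<^sub>v x) $ k = 0\<^sub>v ?N $ k" using k by simp
  qed (use Ac in simp)
  have xy: "x \<in> carrier_vec ?N" "y \<in> carrier_vec ?N" by (simp_all add: x_def y_def)
  have "frob_form A y x = (\<Sum>l<?N. \<Sum>h<?N. f l * (A $$ (l, h) * cofactor A h j ^ q))"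
    unfolding frob_form_eq_sum[OF Ac xy(2,1)]
    by (intro sum.cong refl) (simp add: x_def y_def)
  hence "frob_form A y x ^ q = radical_pairing ?N q i j A"
    by (simp add: radical_pairing_def hom.hom_sum power_mult_distrib f power_mult
        del: sum.lessThan_Suc add_2_eq_Suc add_2_eq_Suc')
  hence "frob_form A y x \<noteq> 0" using nz q_gt_1 by auto
  thus ?thesis using Ac r Ay Ax by (intro corank_one_frob_equiv[of A m y x]) (auto simp: x_def y_def)
qed

section \<open>The normal form\<close>

lemma W_mat_index:
  assumes "i < Suc (Suc m)" "j < Suc (Suc m)"
  shows "W_mat (Suc m) m $$ (i, j)
    = (if i = j \<and> i < m \<or> i = Suc m \<and> j = m then 1 else (0 :: 'a::field))"
  using assms by (auto simp: W_mat_def subdiag_mat_def)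

lemma W_mat_carrier: "(W_mat (Suc m) m :: 'a::field mat) \<in> carrier_mat (Suc (Suc m)) (Suc (Suc m))"
  by (rule carrier_matI) (simp_all add: W_mat_def subdiag_mat_def)

lemma W_mat_rows_cols:
  shows row_W_mat: "i < m \<Longrightarrow> row (W_mat (Suc m) m :: 'a::field mat) i = unit_vec (Suc (Suc m)) i"
    and row_W_mat_last: "row (W_mat (Suc m) m :: 'a mat) (Suc m) = unit_vec (Suc (Suc m)) m"
    and col_W_mat: "j < m \<Longrightarrow> col (W_mat (Suc m) m :: 'a mat) j = unit_vec (Suc (Suc m)) j"
    and col_W_mat_penultimate: "col (W_mat (Suc m) m :: 'a mat) m = unit_vec (Suc (Suc m)) (Suc m)"
proof -
  note c = carrier_matD[OF W_mat_carrier[of m, where ?'a = 'a]]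
  show "i < m \<Longrightarrow> row (W_mat (Suc m) m :: 'a mat) i = unit_vec (Suc (Suc m)) i"
    by (rule eq_vecI) (simp_all add: c W_mat_index)
  show "row (W_mat (Suc m) m :: 'a mat) (Suc m) = unit_vec (Suc (Suc m)) m"
    by (rule eq_vecI) (simp_all add: c W_mat_index)
  show "j < m \<Longrightarrow> col (W_mat (Suc m) m :: 'a mat) j = unit_vec (Suc (Suc m)) j"
    by (rule eq_vecI) (simp_all add: c W_mat_index)
  show "col (W_mat (Suc m) m :: 'a mat) m = unit_vec (Suc (Suc m)) (Suc m)"
    by (rule eq_vecI) (simp_all add: c W_mat_index)
qed

text \<open>Adding the matrix \<open>Z\<close> with a single entry 1 turns \<open>W\<close> into a permutation matrix of order two, so
the rank of \<open>W\<close> is at least its size minus one; and the last column of \<open>W\<close> is zero.\<close>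

lemma W_mat_rank: "(W_mat (Suc m) m :: 'a::field mat) \<in> rank_locus (Suc (Suc m)) (Suc m)"
proof -
  let ?N = "Suc (Suc m)" and ?W = "W_mat (Suc m) m :: 'a mat"
  interpret V: vec_space "TYPE('a)" ?N .
  have W: "?W \<in> carrier_mat ?N ?N" by (rule W_mat_carrier)
  define Z where "Z = mat ?N ?N (\<lambda>(i, j). (if i = m then 1 else 0) * (if j = Suc m then 1 else (0 :: 'a)))"
  have Z: "Z \<in> carrier_mat ?N ?N" by (simp add: Z_def)
  have WZ: "(?W + Z) $$ (i, j) = (if i = (if j = m then Suc m else if j = Suc m then m else j) then 1 else 0)"
    if "i < ?N" "j < ?N" for i j
    using that W by (auto simp: Z_def W_mat_index)
  have c: "?W + Z \<in> carrier_mat ?N ?N" using W Z by simp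
  have "(?W + Z) * (?W + Z) = 1\<^sub>m ?N"
  proof (rule eq_matI)
    fix i j assume ij: "i < dim_row (1\<^sub>m ?N :: 'a mat)" "j < dim_col (1\<^sub>m ?N :: 'a mat)"
    let ?s = "\<lambda>j. if j = m then Suc m else if j = Suc m then m else j"
    have "col (?W + Z) j = unit_vec ?N (?s j)"
      using ij c by (intro eq_vecI) (auto simp: WZ simp del: index_add_mat)
    hence "((?W + Z) * (?W + Z)) $$ (i, j) = row (?W + Z) i \<bullet> unit_vec ?N (?s j)"
      using ij c by (simp del: index_add_mat)
    also have "\<dots> = (?W + Z) $$ (i, ?s j)" using ij c by (auto simp del: index_add_mat)
    also have "\<dots> = 1\<^sub>m ?N $$ (i, j)" using ij by (subst WZ) auto
    finally show "((?W + Z) * (?W + Z)) $$ (i, j) = 1\<^sub>m ?N $$ (i, j)" .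
  qed (use c in auto)
  hence "det (?W + Z) * det (?W + Z) = 1" using det_mult[OF c c] by simp
  hence "det (?W + Z) \<noteq> 0" by auto
  hence "V.rank (?W + Z) = ?N" using V.low_rank_det_zero[OF c] by simp
  moreover have "V.rank (?W + Z) \<le> V.rank ?W + V.rank Z" by (rule V.rank_subadditive[OF W Z])
  moreover have "V.rank Z \<le> 1"
    by (rule V.rank_le_1_product_entries[OF Z]) (simp add: Z_def)
  moreover have "?W *\<^sub>v unit_vec ?N (Suc m) = 0\<^sub>v ?N"
    using W by (intro eq_vecI) (auto simp: W_mat_index)
  hence "det ?W = 0"
    using det_0_iff_vec_prod_zero[OF W] unit_vec_nonzero[of "Suc m" ?N] unit_vec_carrier by blast
  hence "V.rank ?W < ?N" by (rule V.det_zero_low_rank[OF W])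
  ultimately have "V.rank ?W = Suc m" by linarith
  thus ?thesis using W by (simp add: rank_locus_def)
qed

text \<open>The adjugate of \<open>W\<close> is zero except in the last row and last but one column, where a signed
minor of the identity stands.\<close>

lemma W_mat_radical_pairing:
  assumes q: "0 < q"
  shows "radical_pairing (Suc (Suc m)) q m (Suc m) (W_mat (Suc m) m :: 'a::field mat) \<noteq> 0"
proof -
  let ?N = "Suc (Suc m)" and ?W = "W_mat (Suc m) m :: 'a mat"
  have W: "?W \<in> carrier_mat ?N ?N" by (rule W_mat_carrier)
  have "det ?W = 0" using det_zero_of_rank[of ?W "Suc m"] W_mat_rank[of m, where ?'a = 'a] by (simp add: rank_locus_def)
  note adj = adj_mat[OF W, unfolded this]
  have adj_nth: "adj_mat ?W $$ (l, h) = cofactor ?W h l" if "l < ?N" "h < ?N" for l h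
    using that W by (simp add: adj_mat_def)
  \<comment> \<open>The two products of \<open>W\<close> with its adjugate vanish; reading off their entries isolates single cofactors.\<close>
  have col0: "cofactor ?W m l = 0" if "l < Suc m" for l
  proof -
    let ?k = "if l = m then Suc m else l"
    have "row ?W ?k = unit_vec ?N l" using that row_W_mat[where ?'a = 'a] row_W_mat_last[where ?'a = 'a] by auto
    moreover have "col (adj_mat ?W) m \<in> carrier_vec ?N" using adj(1) by (intro carrier_vecI) simp
    ultimately have "(?W * adj_mat ?W) $$ (?k, m) = adj_mat ?W $$ (l, m)"
      using that W adj(1) by simp
    thus ?thesis using that by (simp add: adj adj_nth)
  qed
  have row0: "cofactor ?W h (Suc m) = 0" if "h < ?N" "h \<noteq> m" for h
  proof -
    let ?k = "if h = Suc m then m else h"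
    have "col ?W ?k = unit_vec ?N h" using that col_W_mat[where ?'a = 'a] col_W_mat_penultimate[where ?'a = 'a] by auto
    hence "(adj_mat ?W * ?W) $$ (Suc m, ?k) = adj_mat ?W $$ (Suc m, h)" using that W adj(1) by auto
    thus ?thesis using that by (simp add: adj adj_nth split: if_splits)
  qed
  have "mat_delete ?W m (Suc m) = 1\<^sub>m (Suc m)" (is "?D = _")
  proof (rule eq_matI)
    fix i j assume "i < dim_row (1\<^sub>m (Suc m) :: 'a mat)" "j < dim_col (1\<^sub>m (Suc m) :: 'a mat)"
    hence ij: "i < Suc m" "j < Suc m" by simp_all
    hence "?D $$ (i, j) = ?W $$ (if i < m then i else Suc i, j)"
      using carrier_matD[OF W] by (simp add: mat_delete_def)
    also have "\<dots> = 1\<^sub>m (Suc m) $$ (i, j)"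
    proof (cases "i < m")
      case True
      thus ?thesis using ij by (simp add: W_mat_index)
    next
      case False
      hence "i = m" using ij(1) by simp
      thus ?thesis using ij(2) by (simp add: W_mat_index)
    qed
    finally show "?D $$ (i, j) = 1\<^sub>m (Suc m) $$ (i, j)" .
  qed (use carrier_matD[OF W] in \<open>simp_all add: mat_delete_def\<close>)
  hence "cofactor ?W m (Suc m) = (-1) ^ (m + Suc m)" unfolding cofactor_def by (simp only: det_one mult_1_right)
  hence nz: "cofactor ?W m (Suc m) \<noteq> 0" by simp
  let ?c = "cofactor ?W"
  have "radical_pairing ?N q m (Suc m) ?W =
      (\<Sum>l\<in>{Suc m}. \<Sum>h<?N. ?c m l * (?W $$ (l, h) ^ q * ?c h (Suc m) ^ (q * q)))"
    unfolding radical_pairing_def by (rule sum.mono_neutral_right) (use col0 in auto)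
  also have "\<dots> = (\<Sum>h<?N. ?c m (Suc m) * (?W $$ (Suc m, h) ^ q * ?c h (Suc m) ^ (q * q)))"
    by simp
  also have "\<dots> = (\<Sum>h\<in>{m}. ?c m (Suc m) * (?W $$ (Suc m, h) ^ q * ?c h (Suc m) ^ (q * q)))"
    by (rule sum.mono_neutral_right) (use row0 q in auto)
  also have "\<dots> = ?c m (Suc m) * ?c m (Suc m) ^ (q * q)" using q by (simp add: W_mat_index)
  finally show ?thesis using nz by simp
qed

section \<open>The general matrix of corank one\<close>

lemma closure_of_eq_topspace_iff_meets:
  "X closure_of S = topspace X \<longleftrightarrow>
     (\<forall>T. openin X T \<longrightarrow> T \<noteq> {} \<longrightarrow> S \<inter> T \<noteq> {})"
  unfolding closure_of_def using openin_subset by fast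

theorem corollary1p3:
  fixes n p e q :: nat
  assumes "CHAR('a::alg_closed_field) = p" and "p > 0"
    and "e \<ge> 1" and "q = p ^ e" and "n \<ge> 1"
  shows "\<exists>U :: 'a mat set.
           openin (subtopology (zariski_topology (n + 1)) (rank_locus (n + 1) n)) U \<and>
           subtopology (zariski_topology (n + 1)) (rank_locus (n + 1) n) closure_of U
             = rank_locus (n + 1) n \<and>
           (\<forall>A \<in> U. frob_equiv (n + 1) q A (W_mat n (n - 1)))"
proof -
  obtain m where n: "n = Suc m" using assms(5) by (cases n) auto
  let ?N = "Suc (Suc m)" and ?W = "W_mat (Suc m) m :: 'a mat" and ?R = "rank_locus (Suc (Suc m)) (Suc m) :: 'a mat set"
  have p: "prime CHAR('a)" using assms(1,2) by (intro prime_CHAR_semidom) simp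
  have q1: "1 < q"
    unfolding assms(4) using p assms(1,3) by (intro one_less_power) (use prime_gt_1_nat[OF p] in auto)
  interpret frobenius "TYPE('a)" q
  proof
    fix x y :: 'a
    show "(x + y) ^ q = x ^ q + y ^ q"
      by (rule freshmans_dream'[OF p, of q e]) (simp add: assms(1,4))
  qed (rule q1)
  have W: "?W = four_block_mat (1\<^sub>m m) (0\<^sub>m m 2) (0\<^sub>m 2 m) (subdiag_mat 2)"
    by (simp add: W_mat_def numeral_2_eq_2)
  \<comment> \<open>The pairings as members of \<open>poly_funs\<close>; they cut out the complement of \<open>U\<close>.\<close>
  define S :: "('a mat \<Rightarrow> 'a) set" where
    "S = {f \<in> poly_funs ?N. \<exists>i<?N. \<exists>j<?N. \<forall>A \<in> carrier_mat ?N ?N. f A = radical_pairing ?N q i j A}"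
  define U where "U = (carrier_mat ?N ?N - zero_locus ?N S) \<inter> ?R"
  let ?X = "subtopology (zariski_topology ?N) ?R"
  have RN: "?R \<subseteq> carrier_mat ?N ?N" by (auto simp: rank_locus_def)
  have open_iff: "openin ?X T \<longleftrightarrow> (\<exists>S' \<subseteq> poly_funs ?N. T = (carrier_mat ?N ?N - zero_locus ?N S') \<inter> ?R)" for T
    unfolding openin_subtopology openin_zariski_topology zariski_open_def by blast
  have top: "topspace ?X = ?R" using RN by (auto simp: topspace_zariski_topology)
  have U_iff: "A \<in> U \<longleftrightarrow> A \<in> ?R \<and> (\<exists>i<?N. \<exists>j<?N. radical_pairing ?N q i j A \<noteq> 0)" for A
  proof -
    have 1: "\<exists>f \<in> S. f A = radical_pairing ?N q i j A"
      if ij: "i < ?N" "j < ?N" and A: "A \<in> carrier_mat ?N ?N" for i j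
    proof -
      obtain f :: "'a mat \<Rightarrow> 'a" where f: "f \<in> poly_funs ?N" "\<forall>A \<in> carrier_mat ?N ?N. radical_pairing ?N q i j A = f A"
        using regular_on_radical_pairing[OF ij, of q, where ?'a = 'a] unfolding regular_on_def by blast
      hence "\<forall>A \<in> carrier_mat ?N ?N. f A = radical_pairing ?N q i j A" by auto
      hence "f \<in> S" unfolding S_def using f(1) ij by blast
      thus ?thesis using f(2) A by auto
    qed
    have 2: "\<exists>i<?N. \<exists>j<?N. f A = radical_pairing ?N q i j A" if "f \<in> S" "A \<in> carrier_mat ?N ?N" for f
      using that unfolding S_def by blast
    have 3: "A \<in> U \<longleftrightarrow> A \<in> ?R \<and> (\<exists>f \<in> S. f A \<noteq> 0)"
      using RN unfolding U_def zero_locus_def by blast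
    show ?thesis
    proof
      assume "A \<in> U"
      then obtain f where f: "f \<in> S" "f A \<noteq> 0" and A: "A \<in> ?R" unfolding 3 by blast
      obtain i j where "i < ?N" "j < ?N" "f A = radical_pairing ?N q i j A"
        using 2[OF f(1) subsetD[OF RN A]] by blast
      thus "A \<in> ?R \<and> (\<exists>i<?N. \<exists>j<?N. radical_pairing ?N q i j A \<noteq> 0)"
        using f(2) A by auto
    next
      assume A: "A \<in> ?R \<and> (\<exists>i<?N. \<exists>j<?N. radical_pairing ?N q i j A \<noteq> 0)"
      then obtain i j where ij: "i < ?N" "j < ?N" "radical_pairing ?N q i j A \<noteq> 0" by blast
      obtain f where f: "f \<in> S" "f A = radical_pairing ?N q i j A"
        using 1[OF ij(1,2)] A RN by blast
      hence "f A \<noteq> 0" using ij(3) by simp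
      thus "A \<in> U" unfolding 3 using f(1) A by blast
    qed
  qed
  have "S \<subseteq> poly_funs ?N" unfolding S_def by blast
  hence U_open: "openin ?X U" unfolding open_iff U_def by (intro exI[of _ S] conjI refl)
  have U_dense: "?X closure_of U = topspace ?X"
    unfolding closure_of_eq_topspace_iff_meets
  proof (intro allI impI)
    fix T assume "openin ?X T" "T \<noteq> {}"
    then obtain S' A where S': "S' \<subseteq> poly_funs ?N" "T = (carrier_mat ?N ?N - zero_locus ?N S') \<inter> ?R"
      and A: "A \<in> T" unfolding open_iff by blast
    then obtain f where f: "f \<in> S'" "f A \<noteq> 0" "A \<in> ?R" unfolding zero_locus_def by blast
    have f_reg: "regular_on ?N f" using f(1) S'(1) by (intro regular_on_poly_funs) blast
    have g: "regular_on ?N (radical_pairing ?N q m (Suc m) :: 'a mat \<Rightarrow> 'a)"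
      by (rule regular_on_radical_pairing) auto
    have "0 < q" using q1 by simp
    note W_pairing = W_mat_radical_pairing[OF this, of m, where ?'a = 'a]
    obtain C where C: "C \<in> ?R" "f C \<noteq> 0" "radical_pairing ?N q m (Suc m) C \<noteq> 0"
      using rank_locus_irreducible[of "Suc m", unfolded Suc_eq_plus1[symmetric],
          OF f_reg g f(3,2) W_mat_rank W_pairing] by blast
    have "\<exists>i<?N. \<exists>j<?N. radical_pairing ?N q i j C \<noteq> 0"
      by (rule exI[of _ m], simp, rule exI[of _ "Suc m"], simp add: C(3))
    hence "C \<in> U" unfolding U_iff using C(1) by blast
    moreover have "C \<in> T" unfolding S'(2) zero_locus_def using C(1,2) RN f(1) by blast
    ultimately show "U \<inter> T \<noteq> {}" by blast
  qed
  have U_equiv: "frob_equiv ?N q A ?W" if AU: "A \<in> U" for A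
  proof -
    obtain i j where "i < ?N" "j < ?N" "A \<in> ?R" "radical_pairing ?N q i j A \<noteq> 0"
      using AU unfolding U_iff by blast
    thus ?thesis using frob_equiv_of_radical_pairing[of A m i j] unfolding W by simp
  qed
  have nN: "n + 1 = ?N" "n = Suc m" "n - 1 = m" using n by simp_all
  show ?thesis
    unfolding nN(1,3) unfolding nN(2)
    by (intro exI[of _ U] conjI ballI U_open U_dense[unfolded top] U_equiv)
qed

end
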